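(* Let $M$ be an isometrically immersed anti-invariant submanifold, of codimension $r$, of a locally metallic Riemannian manifold $(\bar M,J,g)$. Then for any $X,Y\in\Gamma(TM)$: $$\sum_{\alpha=1}^rh_\alpha(X,Y)\,tN_\alpha=-\sum_{\alpha=1}^rg(JY,N_\alpha)A_{N_\alpha}X,$$ $$\sum_{\alpha=1}^rh_\alpha(X,Y)\,nN_\alpha=\sum_{\alpha=1}^rg(JY,N_\alpha)\nabla^\perp_XN_\alpha+\sum_{\alpha=1}^rX(g(JY,N_\alpha))N_\alpha-J(\nabla_XY).$$
   Context: A metallic Riemannian manifold $(\bar M,J,g)$ is a smooth manifold with a $(1,1)$-tensor field $J$ satisfying $J^2=pJ+qI$ for some positive integers $p,q$ and a Riemannian metric $g$ with $g(JX,Y)=g(X,JY)$ for all vector fields $X,Y$. It is locally metallic if $\bar\nabla J=0$, where $\bar\nabla$ is the Levi-Civita connection of $(\bar M,g)$. A submanifold $M$ is anti-invariant if $J(T_xM)\subset T_xM^\perp$ for all $x\in M$. $\nabla$ is the Levi-Civita connection of the induced metric on $M$, $\{N_1,\dots,N_r\}$ a (local) orthonormal frame of the normal bundle, $\nabla^\perp$ the normal connection; the Gauss and Weingarten formulas are $\bar\nabla_XY=\nabla_XY+\sum_\alpha h_\alpha(X,Y)N_\alpha$ and $\bar\nabla_XN_\alpha=-A_{N_\alpha}X+\nabla^\perp_XN_\alpha$, with $h_\alpha$ symmetric and $g(A_{N_\alpha}X,Y)=h_\alpha(X,Y)$. For a normal field $U$, $tU:=(JU)^T$ and $nU:=(JU)^\perp$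 are the tangential and normal components of $JU$. *)

theory Defs
  imports "HOL-Analysis.Analysis"
begin

section \<open>Smooth manifolds\<close>

text \<open>C-k on an open set: all iterated directional derivatives up to order k exist and are
  continuous.\<close>

primrec Ck_on :: "nat \<Rightarrow> 'a::real_normed_vector set \<Rightarrow> ('a \<Rightarrow> 'b::real_normed_vector) \<Rightarrow> bool" where
  "Ck_on 0 S f \<longleftrightarrow> continuous_on S f"
| "Ck_on (Suc k) S f \<longleftrightarrow> (\<forall>x\<in>S. f differentiable (at x)) \<and>
     (\<forall>v. Ck_on k S (\<lambda>x. frechet_derivative f (at x) v))"

definition smooth_on :: "'a::real_normed_vector set \<Rightarrow> ('a \<Rightarrow> 'b::real_normed_vector) \<Rightarrow> bool" where
  "smooth_on S f \<longleftrightarrow> (\<forall>k. Ck_on k S f)"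

text \<open>A chart is a pair of its domain and its coordinate map. A manifold is a whole (Hausdorff,
  second countable) type \<open>'m\<close> with a smooth atlas modelled on a Euclidean space \<open>'e\<close>; its dimension
  is \<open>DIM('e)\<close>.\<close>

type_synonym ('m, 'e) chart = "'m set \<times> ('m \<Rightarrow> 'e)"

definition chart_inv :: "('m, 'e) chart \<Rightarrow> 'e \<Rightarrow> 'm" where
  "chart_inv c = inv_into (fst c) (snd c)"

definition is_chart :: "('m::topological_space, 'e::euclidean_space) chart \<Rightarrow> bool" where
  "is_chart c \<longleftrightarrow> open (fst c) \<and> open (snd c ` fst c) \<and>
     homeomorphism (fst c) (snd c ` fst c) (snd c) (chart_inv c)"

definition smooth_manifold ::
    "('m::{t2_space,second_countable_topology}, 'e::euclidean_space) chart set \<Rightarrow> bool" where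
  "smooth_manifold M \<longleftrightarrow> (\<forall>c\<in>M. is_chart c) \<and> (\<Union>c\<in>M. fst c) = UNIV \<and>
     (\<forall>c\<in>M. \<forall>d\<in>M. smooth_on (snd c ` (fst c \<inter> fst d)) (snd d \<circ> chart_inv c))"

text \<open>Every point is given a preferred chart, and the tangent space at \<open>x\<close> is the model space \<open>'e\<close>,
  a vector being represented by its components in the preferred chart at \<open>x\<close>.  Since the
  preferred chart need not depend continuously on the point, regularity of a section
  \<open>'m \<Rightarrow> 'e\<close> always refers to its components in a fixed chart: \<open>tcoord M c x v\<close> are the components in
  the chart \<open>c\<close> of the tangent vector \<open>v\<close> at \<open>x\<close>.\<close>

definition chart_at :: "('m, 'e) chart set \<Rightarrow> 'm \<Rightarrow> ('m, 'e) chart" where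
  "chart_at M x = (SOME c. c \<in> M \<and> x \<in> fst c)"

definition tcoord ::
    "('m, 'e::euclidean_space) chart set \<Rightarrow> ('m, 'e) chart \<Rightarrow> 'm \<Rightarrow> 'e \<Rightarrow> 'e" where
  "tcoord M c x v =
     frechet_derivative (snd c \<circ> chart_inv (chart_at M x)) (at (snd (chart_at M x) x)) v"

definition smooth_fun :: "('m, 'e::euclidean_space) chart set \<Rightarrow> 'm set \<Rightarrow> ('m \<Rightarrow> real) \<Rightarrow> bool" where
  "smooth_fun M U \<phi> \<longleftrightarrow> (\<forall>c\<in>M. smooth_on (snd c ` (U \<inter> fst c)) (\<phi> \<circ> chart_inv c))"

definition smooth_map ::
    "('m::topological_space, 'e::euclidean_space) chart set \<Rightarrow>
     ('b::topological_space, 'd::euclidean_space) chart set \<Rightarrow> ('m \<Rightarrow> 'b) \<Rightarrow> bool" where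
  "smooth_map M B f \<longleftrightarrow> continuous_on UNIV f \<and>
     (\<forall>c\<in>M. \<forall>d\<in>B. smooth_on (snd c ` (fst c \<inter> f -` fst d)) (snd d \<circ> f \<circ> chart_inv c))"

text \<open>The derivative \<open>u \<phi>\<close> of a function in the direction of a tangent vector \<open>u\<close> at \<open>x\<close>, and the
  differential of a map at \<open>x\<close>.\<close>

definition dfun :: "('m, 'e::euclidean_space) chart set \<Rightarrow> ('m \<Rightarrow> real) \<Rightarrow> 'm \<Rightarrow> 'e \<Rightarrow> real" where
  "dfun M \<phi> x u =
     frechet_derivative (\<phi> \<circ> chart_inv (chart_at M x)) (at (snd (chart_at M x) x)) u"

definition dmap ::
    "('m, 'e::euclidean_space) chart set \<Rightarrow> ('b, 'd::euclidean_space) chart set \<Rightarrow>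
     ('m \<Rightarrow> 'b) \<Rightarrow> 'm \<Rightarrow> 'e \<Rightarrow> 'd" where
  "dmap M B f x u =
     frechet_derivative (snd (chart_at B (f x)) \<circ> f \<circ> chart_inv (chart_at M x))
       (at (snd (chart_at M x) x)) u"

text \<open>Smooth sections over \<open>U\<close> of the pullback bundle of the tangent bundle of \<open>B\<close> along \<open>f\<close>.
  For the identity map of \<open>M\<close> these are the vector fields of \<open>M\<close> on \<open>U\<close>.\<close>

definition smooth_along ::
    "('m, 'e::euclidean_space) chart set \<Rightarrow> ('b, 'd::euclidean_space) chart set \<Rightarrow>
     ('m \<Rightarrow> 'b) \<Rightarrow> 'm set \<Rightarrow> ('m \<Rightarrow> 'd) \<Rightarrow> bool" where
  "smooth_along M B f U V \<longleftrightarrow>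
     (\<forall>c\<in>M. \<forall>d\<in>B. smooth_on (snd c ` (U \<inter> fst c \<inter> f -` fst d))
        (\<lambda>z. tcoord B d (f (chart_inv c z)) (V (chart_inv c z))))"

abbreviation smooth_vf :: "('m, 'e::euclidean_space) chart set \<Rightarrow> 'm set \<Rightarrow> ('m \<Rightarrow> 'e) \<Rightarrow> bool" where
  "smooth_vf M \<equiv> smooth_along M M (\<lambda>x. x)"

definition near :: "'m::topological_space \<Rightarrow> ('m set \<Rightarrow> bool) \<Rightarrow> bool" where
  "near x P \<longleftrightarrow> (\<exists>U. open U \<and> x \<in> U \<and> P U)"

section \<open>Connections and metrics\<close>

text \<open>A connection acts on local sections: \<open>D x u V\<close> is the derivative at \<open>x\<close> of \<open>V\<close> in the direction
  of the tangent vector \<open>u\<close>, and it is constrained only if \<open>V\<close> is smooth near \<open>x\<close>.  The value of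
  \<open>V\<close> away from \<open>x\<close> is irrelevant: apply the Leibniz rule to the indicator function of a
  neighbourhood of \<open>x\<close>, which is smooth near \<open>x\<close>.\<close>

definition connection_along ::
    "('m::topological_space, 'e::euclidean_space) chart set \<Rightarrow> ('b, 'd::euclidean_space) chart set \<Rightarrow>
     ('m \<Rightarrow> 'b) \<Rightarrow> ('m \<Rightarrow> 'e \<Rightarrow> ('m \<Rightarrow> 'd) \<Rightarrow> 'd) \<Rightarrow> bool" where
  "connection_along M B f D \<longleftrightarrow>
     (\<forall>x V. near x (\<lambda>U. smooth_along M B f U V) \<longrightarrow> linear (\<lambda>u. D x u V)) \<and>
     (\<forall>x u V W. near x (\<lambda>U. smooth_along M B f U V) \<and> near x (\<lambda>U. smooth_along M B f U W) \<longrightarrow>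
        D x u (\<lambda>y. V y + W y) = D x u V + D x u W) \<and>
     (\<forall>x u \<phi> V. near x (\<lambda>U. smooth_fun M U \<phi>) \<and> near x (\<lambda>U. smooth_along M B f U V) \<longrightarrow>
        D x u (\<lambda>y. \<phi> y *\<^sub>R V y) = dfun M \<phi> x u *\<^sub>R V x + \<phi> x *\<^sub>R D x u V) \<and>
     (\<forall>U X V. open U \<and> smooth_vf M U X \<and> smooth_along M B f U V \<longrightarrow>
        smooth_along M B f U (\<lambda>x. D x (X x) V))"

abbreviation affine_connection ::
    "('m::topological_space, 'e::euclidean_space) chart set \<Rightarrow>
     ('m \<Rightarrow> 'e \<Rightarrow> ('m \<Rightarrow> 'e) \<Rightarrow> 'e) \<Rightarrow> bool" where
  "affine_connection M \<equiv> connection_along M M (\<lambda>x. x)"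

text \<open>The connection induced by \<open>nabla\<close> on sections along \<open>f\<close>.  It gives the usual meaning to the
  ambient derivative of a field that is only defined along an immersed submanifold: on the
  restriction of an ambient field it is the ambient derivative, and this determines it on all
  sections.\<close>

definition pullback_connection ::
    "('m::topological_space, 'e::euclidean_space) chart set \<Rightarrow>
     ('b::topological_space, 'd::euclidean_space) chart set \<Rightarrow> ('m \<Rightarrow> 'b) \<Rightarrow>
     ('b \<Rightarrow> 'd \<Rightarrow> ('b \<Rightarrow> 'd) \<Rightarrow> 'd) \<Rightarrow> ('m \<Rightarrow> 'e \<Rightarrow> ('m \<Rightarrow> 'd) \<Rightarrow> 'd) \<Rightarrow> bool" where
  "pullback_connection M B f nabla D \<longleftrightarrow> connection_along M B f D \<and>
     (\<forall>x u Z. near (f x) (\<lambda>U. smooth_vf B U Z) \<longrightarrow>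
        D x u (\<lambda>y. Z (f y)) = nabla (f x) (dmap M B f x u) Z)"

definition riemannian_metric ::
    "('m::topological_space, 'e::euclidean_space) chart set \<Rightarrow> ('m \<Rightarrow> 'e \<Rightarrow> 'e \<Rightarrow> real) \<Rightarrow> bool" where
  "riemannian_metric M g \<longleftrightarrow>
     (\<forall>x. bilinear (g x)) \<and> (\<forall>x u v. g x u v = g x v u) \<and> (\<forall>x u. u \<noteq> 0 \<longrightarrow> g x u u > 0) \<and>
     (\<forall>U X Y. open U \<and> smooth_vf M U X \<and> smooth_vf M U Y \<longrightarrow> smooth_fun M U (\<lambda>x. g x (X x) (Y x)))"

text \<open>Torsion freeness is expressed by letting both sides of \<open>\<nabla>\<^sub>X Y - \<nabla>\<^sub>Y X = [X, Y]\<close> act on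
  functions.\<close>

definition torsion_free ::
    "('m::topological_space, 'e::euclidean_space) chart set \<Rightarrow>
     ('m \<Rightarrow> 'e \<Rightarrow> ('m \<Rightarrow> 'e) \<Rightarrow> 'e) \<Rightarrow> bool" where
  "torsion_free M nabla \<longleftrightarrow>
     (\<forall>x X Y \<phi>. near x (\<lambda>U. smooth_vf M U X) \<and> near x (\<lambda>U. smooth_vf M U Y) \<and>
        near x (\<lambda>U. smooth_fun M U \<phi>) \<longrightarrow>
        dfun M \<phi> x (nabla x (X x) Y - nabla x (Y x) X) =
          dfun M (\<lambda>y. dfun M \<phi> y (Y y)) x (X x) - dfun M (\<lambda>y. dfun M \<phi> y (X y)) x (Y x))"

definition metric_connection ::
    "('m::topological_space, 'e::euclidean_space) chart set \<Rightarrow> ('m \<Rightarrow> 'e \<Rightarrow> 'e \<Rightarrow> real) \<Rightarrow>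
     ('m \<Rightarrow> 'e \<Rightarrow> ('m \<Rightarrow> 'e) \<Rightarrow> 'e) \<Rightarrow> bool" where
  "metric_connection M g nabla \<longleftrightarrow>
     (\<forall>x u Y Z. near x (\<lambda>U. smooth_vf M U Y) \<and> near x (\<lambda>U. smooth_vf M U Z) \<longrightarrow>
        dfun M (\<lambda>y. g y (Y y) (Z y)) x u = g x (nabla x u Y) (Z x) + g x (Y x) (nabla x u Z))"

definition levi_civita ::
    "('m::topological_space, 'e::euclidean_space) chart set \<Rightarrow> ('m \<Rightarrow> 'e \<Rightarrow> 'e \<Rightarrow> real) \<Rightarrow>
     ('m \<Rightarrow> 'e \<Rightarrow> ('m \<Rightarrow> 'e) \<Rightarrow> 'e) \<Rightarrow> bool" where
  "levi_civita M g nabla \<longleftrightarrow>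
     affine_connection M nabla \<and> torsion_free M nabla \<and> metric_connection M g nabla"

section \<open>Metallic Riemannian manifolds\<close>

definition tensor_field_11 ::
    "('m::topological_space, 'e::euclidean_space) chart set \<Rightarrow> ('m \<Rightarrow> 'e \<Rightarrow> 'e) \<Rightarrow> bool" where
  "tensor_field_11 M J \<longleftrightarrow> (\<forall>x. linear (J x)) \<and>
     (\<forall>U X. open U \<and> smooth_vf M U X \<longrightarrow> smooth_vf M U (\<lambda>x. J x (X x)))"

definition metallic_riemannian ::
    "('m::{t2_space,second_countable_topology}, 'e::euclidean_space) chart set \<Rightarrow>
     ('m \<Rightarrow> 'e \<Rightarrow> 'e) \<Rightarrow> ('m \<Rightarrow> 'e \<Rightarrow> 'e \<Rightarrow> real) \<Rightarrow> bool" where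
  "metallic_riemannian M J g \<longleftrightarrow>
     smooth_manifold M \<and> riemannian_metric M g \<and> tensor_field_11 M J \<and>
     (\<exists>p q :: nat. 0 < p \<and> 0 < q \<and> (\<forall>x v. J x (J x v) = real p *\<^sub>R J x v + real q *\<^sub>R v)) \<and>
     (\<forall>x u v. g x (J x u) v = g x u (J x v))"

definition cov_deriv_11 ::
    "('m \<Rightarrow> 'e \<Rightarrow> ('m \<Rightarrow> 'e) \<Rightarrow> 'e) \<Rightarrow> ('m \<Rightarrow> 'e \<Rightarrow> 'e) \<Rightarrow> 'm \<Rightarrow> 'e \<Rightarrow> ('m \<Rightarrow> 'e) \<Rightarrow> 'e::euclidean_space"
  where "cov_deriv_11 nabla J x u Z = nabla x u (\<lambda>y. J y (Z y)) - J x (nabla x u Z)"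

text \<open>Locally metallic; \<open>nabla\<close> is the Levi-Civita connection of \<open>g\<close>.\<close>

definition locally_metallic ::
    "('m::{t2_space,second_countable_topology}, 'e::euclidean_space) chart set \<Rightarrow>
     ('m \<Rightarrow> 'e \<Rightarrow> 'e) \<Rightarrow> ('m \<Rightarrow> 'e \<Rightarrow> 'e \<Rightarrow> real) \<Rightarrow> ('m \<Rightarrow> 'e \<Rightarrow> ('m \<Rightarrow> 'e) \<Rightarrow> 'e) \<Rightarrow> bool" where
  "locally_metallic M J g nabla \<longleftrightarrow> metallic_riemannian M J g \<and> levi_civita M g nabla \<and>
     (\<forall>x u Z. near x (\<lambda>U. smooth_vf M U Z) \<longrightarrow> cov_deriv_11 nabla J x u Z = 0)"

section \<open>Isometrically immersed submanifolds\<close>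

definition isometric_immersion ::
    "('m::{t2_space,second_countable_topology}, 'e::euclidean_space) chart set \<Rightarrow>
     ('m \<Rightarrow> 'e \<Rightarrow> 'e \<Rightarrow> real) \<Rightarrow>
     ('b::{t2_space,second_countable_topology}, 'd::euclidean_space) chart set \<Rightarrow>
     ('b \<Rightarrow> 'd \<Rightarrow> 'd \<Rightarrow> real) \<Rightarrow> ('m \<Rightarrow> 'b) \<Rightarrow> bool" where
  "isometric_immersion M gM B g f \<longleftrightarrow>
     smooth_manifold M \<and> riemannian_metric M gM \<and> smooth_manifold B \<and> riemannian_metric B g \<and>
     smooth_map M B f \<and> (\<forall>x. inj (dmap M B f x)) \<and>
     (\<forall>x u v. gM x u v = g (f x) (dmap M B f x u) (dmap M B f x v))"

definition normal_space ::
    "('m, 'e::euclidean_space) chart set \<Rightarrow> ('b, 'd::euclidean_space) chart set \<Rightarrow>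
     ('m \<Rightarrow> 'b) \<Rightarrow> ('b \<Rightarrow> 'd \<Rightarrow> 'd \<Rightarrow> real) \<Rightarrow> 'm \<Rightarrow> 'd set" where
  "normal_space M B f g x = {v. \<forall>u. g (f x) (dmap M B f x u) v = 0}"

definition anti_invariant ::
    "('m, 'e::euclidean_space) chart set \<Rightarrow> ('b, 'd::euclidean_space) chart set \<Rightarrow>
     ('m \<Rightarrow> 'b) \<Rightarrow> ('b \<Rightarrow> 'd \<Rightarrow> 'd \<Rightarrow> real) \<Rightarrow> ('b \<Rightarrow> 'd \<Rightarrow> 'd) \<Rightarrow> bool" where
  "anti_invariant M B f g J \<longleftrightarrow>
     (\<forall>x. J (f x) ` range (dmap M B f x) \<subseteq> normal_space M B f g x)"

text \<open>Tangential and normal parts of an ambient vector at \<open>f x\<close>.  The tangential part is given as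
  the tangent vector of \<open>M\<close> at \<open>x\<close> whose image under the differential of \<open>f\<close> it is.\<close>

definition tangential ::
    "('m, 'e::euclidean_space) chart set \<Rightarrow> ('b, 'd::euclidean_space) chart set \<Rightarrow>
     ('m \<Rightarrow> 'b) \<Rightarrow> ('b \<Rightarrow> 'd \<Rightarrow> 'd \<Rightarrow> real) \<Rightarrow> 'm \<Rightarrow> 'd \<Rightarrow> 'e" where
  "tangential M B f g x v = (THE u. v - dmap M B f x u \<in> normal_space M B f g x)"

definition normal ::
    "('m, 'e::euclidean_space) chart set \<Rightarrow> ('b, 'd::euclidean_space) chart set \<Rightarrow>
     ('m \<Rightarrow> 'b) \<Rightarrow> ('b \<Rightarrow> 'd \<Rightarrow> 'd \<Rightarrow> real) \<Rightarrow> 'm \<Rightarrow> 'd \<Rightarrow> 'd" where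
  "normal M B f g x v = v - dmap M B f x (tangential M B f g x v)"

definition orthonormal_normal_frame ::
    "('m, 'e::euclidean_space) chart set \<Rightarrow> ('b, 'd::euclidean_space) chart set \<Rightarrow>
     ('m \<Rightarrow> 'b) \<Rightarrow> ('b \<Rightarrow> 'd \<Rightarrow> 'd \<Rightarrow> real) \<Rightarrow> 'm set \<Rightarrow> nat \<Rightarrow> (nat \<Rightarrow> 'm \<Rightarrow> 'd) \<Rightarrow> bool" where
  "orthonormal_normal_frame M B f g U r N \<longleftrightarrow>
     (\<forall>\<alpha>\<in>{1..r}. smooth_along M B f U (N \<alpha>)) \<and>
     (\<forall>x\<in>U. span ((\<lambda>\<alpha>. N \<alpha> x) ` {1..r}) = normal_space M B f g x \<and>
        (\<forall>\<alpha>\<in>{1..r}. \<forall>\<beta>\<in>{1..r}. g (f x) (N \<alpha> x) (N \<beta> x) = (if \<alpha> = \<beta> then 1 else 0)))"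

text \<open>The coefficients in the Gauss and Weingarten formulas, for a normal field \<open>\<xi>\<close>.  Here \<open>D\<close> is the
  ambient connection along \<open>f\<close>; \<open>h_coeff\<close> is the component in the direction of \<open>\<xi>\<close> of the second
  fundamental form, i.e. of the normal part of the ambient derivative of \<open>Y\<close> in the direction \<open>X\<close>.
  That the tangential part of that derivative is given by the Levi-Civita connection of the
  induced metric is not part of the definition.\<close>

definition h_coeff ::
    "('m, 'e::euclidean_space) chart set \<Rightarrow> ('b, 'd::euclidean_space) chart set \<Rightarrow>
     ('m \<Rightarrow> 'b) \<Rightarrow> ('b \<Rightarrow> 'd \<Rightarrow> 'd \<Rightarrow> real) \<Rightarrow> ('m \<Rightarrow> 'e \<Rightarrow> ('m \<Rightarrow> 'd) \<Rightarrow> 'd) \<Rightarrow>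
     ('m \<Rightarrow> 'd) \<Rightarrow> ('m \<Rightarrow> 'e) \<Rightarrow> ('m \<Rightarrow> 'e) \<Rightarrow> 'm \<Rightarrow> real" where
  "h_coeff M B f g D \<xi> X Y x =
     g (f x) (normal M B f g x (D x (X x) (\<lambda>y. dmap M B f y (Y y)))) (\<xi> x)"

definition shape_operator ::
    "('m, 'e::euclidean_space) chart set \<Rightarrow> ('b, 'd::euclidean_space) chart set \<Rightarrow>
     ('m \<Rightarrow> 'b) \<Rightarrow> ('b \<Rightarrow> 'd \<Rightarrow> 'd \<Rightarrow> real) \<Rightarrow> ('m \<Rightarrow> 'e \<Rightarrow> ('m \<Rightarrow> 'd) \<Rightarrow> 'd) \<Rightarrow>
     ('m \<Rightarrow> 'd) \<Rightarrow> 'm \<Rightarrow> 'e \<Rightarrow> 'e" where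
  "shape_operator M B f g D \<xi> x u = - tangential M B f g x (D x u \<xi>)"

definition normal_connection ::
    "('m, 'e::euclidean_space) chart set \<Rightarrow> ('b, 'd::euclidean_space) chart set \<Rightarrow>
     ('m \<Rightarrow> 'b) \<Rightarrow> ('b \<Rightarrow> 'd \<Rightarrow> 'd \<Rightarrow> real) \<Rightarrow> ('m \<Rightarrow> 'e \<Rightarrow> ('m \<Rightarrow> 'd) \<Rightarrow> 'd) \<Rightarrow>
     'm \<Rightarrow> 'e \<Rightarrow> ('m \<Rightarrow> 'd) \<Rightarrow> 'd" where
  "normal_connection M B f g D x u \<xi> = normal M B f g x (D x u \<xi>)"

end

theory Submission
  imports Defs
begin

text \<open>
  Write \<open>D\<close> for the ambient connection along the immersion \<open>f\<close> and \<open>V = f\<^sub>*Y\<close>.  As \<open>M\<close> is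
  anti-invariant, \<open>JV\<close> is a normal field, so \<open>JV = \<Sum> \<phi>\<^sub>\<alpha> N\<^sub>\<alpha>\<close> with \<open>\<phi>\<^sub>\<alpha> = g(JV, N\<^sub>\<alpha>)\<close> wherever the frame
  is defined.  The derivative of \<open>JV\<close> in the direction of \<open>X\<close> is then computed twice.  The Leibniz
  rule gives \<open>\<Sum> X(\<phi>\<^sub>\<alpha>) N\<^sub>\<alpha> + \<Sum> \<phi>\<^sub>\<alpha> D\<^sub>X N\<^sub>\<alpha>\<close>.  As \<open>J\<close> is parallel, the derivative is also \<open>J(D\<^sub>X V)\<close>, which
  by the Gauss formula is \<open>J(f\<^sub>*(\<nabla>\<^sub>X Y)) + \<Sum> h\<^sub>\<alpha>(X, Y) J N\<^sub>\<alpha>\<close>.  The vector \<open>J(f\<^sub>*(\<nabla>\<^sub>X Y))\<close> is again normal,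
  and the two identities are the tangential and the normal part of the resulting equation.

  The connection \<open>D\<close> is tied to the ambient Levi-Civita connection on restrictions \<open>Z \<circ> f\<close> of ambient
  fields only, while \<open>V\<close> and the \<open>N\<^sub>\<alpha>\<close> are fields along \<open>f\<close> that need not be of this kind.  The bridge is the
  induction principle \<open>section_induct\<close>: near a point every section along \<open>f\<close> is a combination, with
  smooth coefficients, of restrictions of coordinate fields.  It yields that \<open>D\<close> is metric
  (\<open>pullback_metric\<close>) and commutes with \<open>J\<close> (\<open>pullback_parallel\<close>); the same frame shows that \<open>D\<close> is torsion
  free along \<open>f\<close> (\<open>pullback_torsion_free\<close>).

  The Gauss formula (\<open>gauss_formula\<close>) is proved with the argument that shows the uniqueness of
  Levi-Civita connections: \<open>g(D\<^sub>X f\<^sub>*Y, f\<^sub>*Z) - g\<^sub>M(\<nabla>\<^sub>X Y, Z)\<close> is symmetric in \<open>X, Y\<close> and skew in \<open>Y, Z\<close>,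
  hence zero.
\<close>

section \<open>Calculus of smooth functions on open sets\<close>

lemma frechet_derivative_eqI:
  "(f has_derivative F) (at x) \<Longrightarrow> frechet_derivative f (at x) = F"
  using frechet_derivative_at by metis

lemma has_derivative_cong_open:
  assumes "open S" "x \<in> S" "\<And>y. y \<in> S \<Longrightarrow> f y = g y"
  shows "(f has_derivative F) (at x) \<longleftrightarrow> (g has_derivative F) (at x)"
  using has_derivative_transform_within_open[of f F x UNIV S g]
    has_derivative_transform_within_open[of g F x UNIV S f] assms
  by auto

lemma frechet_derivative_cong_open:
  assumes "open S" "x \<in> S" "\<And>y. y \<in> S \<Longrightarrow> f y = g y"
  shows "frechet_derivative f (at x) = frechet_derivative g (at x)"
  unfolding frechet_derivative_def using has_derivative_cong_open[OF assms] by simp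

lemma Ck_on_cong:
  assumes "open S" "\<And>y. y \<in> S \<Longrightarrow> f y = g y"
  shows "Ck_on k S f \<longleftrightarrow> Ck_on k S g"
  using assms
proof (induction k arbitrary: f g)
  case 0
  then show ?case by (simp cong: continuous_on_cong)
next
  case (Suc k)
  have "Ck_on k S (\<lambda>x. frechet_derivative f (at x) v) \<longleftrightarrow>
      Ck_on k S (\<lambda>x. frechet_derivative g (at x) v)" for v
    using Suc.prems frechet_derivative_cong_open[of S _ f g] by (intro Suc.IH) auto
  moreover have "f differentiable (at x) \<longleftrightarrow> g differentiable (at x)" if "x \<in> S" for x
    unfolding differentiable_def using has_derivative_cong_open[of S x f g] Suc.prems that by simp
  ultimately show ?case by simp
qed

lemma Ck_on_subset: "Ck_on k S f \<Longrightarrow> T \<subseteq> S \<Longrightarrow> Ck_on k T f"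
  by (induction k arbitrary: f) (auto intro: continuous_on_subset)

lemma Ck_on_Suc: "Ck_on (Suc k) S f \<Longrightarrow> Ck_on k S f"
proof (induction k arbitrary: f)
  case 0
  then show ?case
    by (auto intro!: differentiable_imp_continuous_on differentiable_at_imp_differentiable_on)
qed auto

lemma Ck_on_const [simp]: "Ck_on k S (\<lambda>x. c)"
proof (induction k arbitrary: c)
  case (Suc k)
  then show ?case by simp
qed simp

text \<open>A derivative given on \<open>S\<close> only suffices, because on an open set smoothness does not see the values
  taken elsewhere.\<close>

lemma Ck_on_SucI:
  assumes "open S" "\<And>x. x \<in> S \<Longrightarrow> (f has_derivative F x) (at x)"
    "\<And>v. Ck_on k S (\<lambda>x. F x v)"
  shows "Ck_on (Suc k) S f"
proof -
  have "Ck_on k S (\<lambda>x. frechet_derivative f (at x) v)" for v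
    using assms(3)[of v] Ck_on_cong[OF assms(1), of "\<lambda>x. frechet_derivative f (at x) v" "\<lambda>x. F x v" k]
      frechet_derivative_eqI[OF assms(2)] by auto
  then show ?thesis using assms(2) by (auto simp: differentiable_def)
qed

lemma Ck_on_SucD:
  assumes "Ck_on (Suc k) S f"
  shows "\<And>x. x \<in> S \<Longrightarrow> (f has_derivative frechet_derivative f (at x)) (at x)"
    "\<And>v. Ck_on k S (\<lambda>x. frechet_derivative f (at x) v)"
  using assms by (auto simp: frechet_derivative_works)

lemma Ck_on_add:
  assumes "open S" "Ck_on k S f" "Ck_on k S g"
  shows "Ck_on k S (\<lambda>x. f x + g x)"
  using assms
proof (induction k arbitrary: f g)
  case 0
  then show ?case by (auto intro: continuous_intros)
next
  case (Suc k)
  note D = Ck_on_SucD[OF Suc.prems(2)] Ck_on_SucD[OF Suc.prems(3)]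
  show ?case
    by (rule Ck_on_SucI[OF Suc.prems(1) has_derivative_add[OF D(1,3)]])
      (use Suc D in auto)
qed

lemma Ck_on_sum:
  assumes "open S" "\<And>i. i \<in> I \<Longrightarrow> Ck_on k S (f i)"
  shows "Ck_on k S (\<lambda>x. \<Sum>i\<in>I. f i x)"
proof (cases "finite I")
  case True
  then show ?thesis using assms(2)
    by (induction I rule: finite_induct) (auto intro: Ck_on_add[OF assms(1)])
qed simp

lemma Ck_on_scaleR:
  assumes "open S" "Ck_on k S \<phi>" "Ck_on k S f"
  shows "Ck_on k S (\<lambda>x. \<phi> x *\<^sub>R f x)"
  using assms
proof (induction k arbitrary: \<phi> f)
  case 0
  then show ?case by (auto intro: continuous_intros)
next
  case (Suc k)
  note D = Ck_on_SucD[OF Suc.prems(2)] Ck_on_SucD[OF Suc.prems(3)]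
  show ?case
    by (rule Ck_on_SucI[OF Suc.prems(1) has_derivative_scaleR[OF D(1,3)]])
      (assumption | intro Ck_on_add Suc.IH Suc.prems(1) D(2,4) Ck_on_Suc[OF Suc.prems(2)]
        Ck_on_Suc[OF Suc.prems(3)])+
qed

lemma Ck_on_linear:
  assumes "open S" "bounded_linear L" "Ck_on k S f"
  shows "Ck_on k S (\<lambda>x. L (f x))"
  using assms
proof (induction k arbitrary: f)
  case 0
  then show ?case by (simp add: bounded_linear.continuous_on)
next
  case (Suc k)
  note D = Ck_on_SucD[OF Suc.prems(3)]
  show ?case
    by (rule Ck_on_SucI[OF Suc.prems(1) bounded_linear.has_derivative[OF Suc.prems(2) D(1)]])
      (use Suc D in auto)
qed

text \<open>By the chain rule the derivative of \<open>g \<circ> f\<close> evaluates the derivative of \<open>g\<close> on a vector that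
  moves with the point; expanding this vector in the standard basis leaves compositions of \<open>f\<close>
  with the directional derivatives of \<open>g\<close> in fixed directions, to which the induction applies.\<close>

lemma Ck_on_compose:
  fixes f :: "'a::real_normed_vector \<Rightarrow> 'b::euclidean_space"
  assumes "open S" "Ck_on k S f" "Ck_on k T g" "f ` S \<subseteq> T"
  shows "Ck_on k S (\<lambda>x. g (f x))"
  using assms
proof (induction k arbitrary: g)
  case 0
  then show ?case by (auto intro: continuous_on_compose2)
next
  case (Suc k)
  note Df = Ck_on_SucD[OF Suc.prems(2)] and Dg = Ck_on_SucD[OF Suc.prems(3)]
  let ?F = "\<lambda>x. frechet_derivative f (at x)" and ?G = "\<lambda>y. frechet_derivative g (at y)"
  have expand: "?G (f x) (?F x v) = (\<Sum>b\<in>Basis. (?F x v \<bullet> b) *\<^sub>R ?G (f x) b)" if "x \<in> S" for x v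
  proof -
    have "linear (?G (f x))"
      using Dg(1) Suc.prems(4) that has_derivative_linear by blast
    then show ?thesis
      by (subst euclidean_representation[of "?F x v", symmetric])
        (simp only: linear_sum linear_cmul)
  qed
  have "Ck_on k S (\<lambda>x. \<Sum>b\<in>Basis. (?F x v \<bullet> b) *\<^sub>R ?G (f x) b)" for v
    by (intro Ck_on_sum Ck_on_scaleR Suc.prems(1) Df(2) Suc.IH Suc.prems(4) Dg(2)
        Ck_on_linear[OF Suc.prems(1) bounded_linear_inner_left] Ck_on_Suc[OF Suc.prems(2)])
  then have "Ck_on k S (\<lambda>x. ?G (f x) (?F x v))" for v
    using Ck_on_cong[OF Suc.prems(1), of "\<lambda>x. ?G (f x) (?F x v)"] expand by auto
  moreover have "((\<lambda>x. g (f x)) has_derivative (\<lambda>v. ?G (f x) (?F x v))) (at x)" if "x \<in> S" for x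
    using diff_chain_at[OF Df(1) Dg(1)] that Suc.prems(4) by (auto simp: o_def)
  ultimately show ?case by (intro Ck_on_SucI[OF Suc.prems(1)])
qed

lemma smooth_on_cong: "open S \<Longrightarrow> (\<And>y. y \<in> S \<Longrightarrow> f y = g y) \<Longrightarrow> smooth_on S f \<longleftrightarrow> smooth_on S g"
  unfolding smooth_on_def using Ck_on_cong by blast

lemma smooth_on_transfer:
  "open S \<Longrightarrow> smooth_on S f \<Longrightarrow> (\<And>y. y \<in> S \<Longrightarrow> f y = g y) \<Longrightarrow> smooth_on S g"
  using smooth_on_cong by blast

lemma smooth_on_subset: "smooth_on S f \<Longrightarrow> T \<subseteq> S \<Longrightarrow> smooth_on T f"
  unfolding smooth_on_def using Ck_on_subset by blast

lemma smooth_on_const [simp]: "smooth_on S (\<lambda>x. c)"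
  unfolding smooth_on_def by simp

lemma smooth_on_add: "open S \<Longrightarrow> smooth_on S f \<Longrightarrow> smooth_on S g \<Longrightarrow> smooth_on S (\<lambda>x. f x + g x)"
  unfolding smooth_on_def using Ck_on_add by blast

lemma smooth_on_sum:
  "open S \<Longrightarrow> (\<And>i. i \<in> I \<Longrightarrow> smooth_on S (f i)) \<Longrightarrow> smooth_on S (\<lambda>x. \<Sum>i\<in>I. f i x)"
  unfolding smooth_on_def using Ck_on_sum[of S I] by blast

lemma smooth_on_scaleR:
  "open S \<Longrightarrow> smooth_on S \<phi> \<Longrightarrow> smooth_on S f \<Longrightarrow> smooth_on S (\<lambda>x. \<phi> x *\<^sub>R f x)"
  unfolding smooth_on_def using Ck_on_scaleR by blast

lemma smooth_on_inner_const: "open S \<Longrightarrow> smooth_on S f \<Longrightarrow> smooth_on S (\<lambda>x. f x \<bullet> b)"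
  unfolding smooth_on_def using Ck_on_linear[OF _ bounded_linear_inner_left] by blast

lemma smooth_on_compose:
  fixes f :: "'a::real_normed_vector \<Rightarrow> 'b::euclidean_space"
  shows "open S \<Longrightarrow> smooth_on S f \<Longrightarrow> smooth_on T g \<Longrightarrow> f ` S \<subseteq> T \<Longrightarrow> smooth_on S (\<lambda>x. g (f x))"
  unfolding smooth_on_def using Ck_on_compose by blast

lemma smooth_on_has_derivative:
  assumes "smooth_on S f" "x \<in> S"
  shows "(f has_derivative frechet_derivative f (at x)) (at x)"
  using assms Ck_on_SucD(1)[of 0] unfolding smooth_on_def by blast

lemma smooth_on_frechet_derivative:
  assumes "smooth_on S f"
  shows "smooth_on S (\<lambda>x. frechet_derivative f (at x) v)"
  using assms Ck_on_SucD(2) unfolding smooth_on_def by blast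

lemma smooth_on_frechet_derivative_apply:
  fixes f :: "'a::euclidean_space \<Rightarrow> 'b::real_normed_vector"
  assumes "open S" "smooth_on S f" "smooth_on S w"
  shows "smooth_on S (\<lambda>x. frechet_derivative f (at x) (w x))"
proof -
  have "frechet_derivative f (at x) (w x) = (\<Sum>b\<in>Basis. (w x \<bullet> b) *\<^sub>R frechet_derivative f (at x) b)"
    if "x \<in> S" for x
  proof -
    have "linear (frechet_derivative f (at x))"
      using has_derivative_linear[OF smooth_on_has_derivative[OF assms(2) that]] .
    then show ?thesis
      by (subst euclidean_representation[of "w x", symmetric]) (simp only: linear_sum linear_cmul)
  qed
  moreover have "smooth_on S (\<lambda>x. \<Sum>b\<in>Basis. (w x \<bullet> b) *\<^sub>R frechet_derivative f (at x) b)"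
    by (intro smooth_on_sum smooth_on_scaleR smooth_on_inner_const smooth_on_frechet_derivative assms)
  ultimately show ?thesis
    using smooth_on_cong[OF assms(1), of "\<lambda>x. frechet_derivative f (at x) (w x)"] by auto
qed

section \<open>Derivatives on manifolds\<close>

context
  fixes M :: "('m::{t2_space,second_countable_topology}, 'e::euclidean_space) chart set"
  assumes M: "smooth_manifold M"
begin

lemma chart_at_in: "chart_at M x \<in> M" "x \<in> fst (chart_at M x)"
proof -
  have "\<exists>c. c \<in> M \<and> x \<in> fst c" using M unfolding smooth_manifold_def by blast
  then have "chart_at M x \<in> M \<and> x \<in> fst (chart_at M x)"
    unfolding chart_at_def by (rule someI_ex)
  then show "chart_at M x \<in> M" "x \<in> fst (chart_at M x)" by auto
qed

lemma is_chartM: "c \<in> M \<Longrightarrow> is_chart c"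
  using M unfolding smooth_manifold_def by blast

lemma open_chart: "c \<in> M \<Longrightarrow> open (fst c)"
  using is_chartM unfolding is_chart_def by blast

lemma chart_inv_left: "c \<in> M \<Longrightarrow> x \<in> fst c \<Longrightarrow> chart_inv c (snd c x) = x"
  using is_chartM unfolding is_chart_def homeomorphism_def by blast

lemma open_chart_image:
  assumes "c \<in> M" "open A" shows "open (snd c ` (A \<inter> fst c))"
proof -
  have h: "homeomorphism (fst c) (snd c ` fst c) (snd c) (chart_inv c)"
    and o: "open (snd c ` fst c)" "open (fst c)"
    using is_chartM[OF assms(1)] unfolding is_chart_def by auto
  have "openin (top_of_set (snd c ` fst c)) (snd c ` (A \<inter> fst c))"
    by (rule homeomorphism_imp_open_map[OF h]) (use assms(2) in \<open>auto simp: openin_open\<close>)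
  then show ?thesis using o(1) openin_open_trans by blast
qed

lemma transition_smooth:
  "c \<in> M \<Longrightarrow> d \<in> M \<Longrightarrow> smooth_on (snd c ` (fst c \<inter> fst d)) (\<lambda>z. snd d (chart_inv c z))"
  using M unfolding smooth_manifold_def o_def by blast

end

text \<open>The derivative at a point, in the direction of tangent vectors, of a map from a manifold to a
  vector space. It subsumes the three derivatives \<open>dfun\<close>, \<open>tcoord\<close> and \<open>dmap\<close>, so that one chain
  rule serves them all.\<close>

definition has_mderiv ::
    "('m, 'e::euclidean_space) chart set \<Rightarrow> ('m \<Rightarrow> 'v::real_normed_vector) \<Rightarrow> 'm \<Rightarrow> ('e \<Rightarrow> 'v) \<Rightarrow> bool"
  where "has_mderiv M \<phi> x L \<longleftrightarrow>
    ((\<phi> \<circ> chart_inv (chart_at M x)) has_derivative L) (at (snd (chart_at M x) x))"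

lemma has_mderiv_unique: "has_mderiv M \<phi> x L \<Longrightarrow> has_mderiv M \<phi> x L' \<Longrightarrow> L = L'"
  unfolding has_mderiv_def by (rule has_derivative_unique)

lemma has_mderiv_linear: "has_mderiv M \<phi> x L \<Longrightarrow> linear L"
  unfolding has_mderiv_def by (rule has_derivative_linear)

lemma dfun_eq: "has_mderiv M \<phi> x L \<Longrightarrow> dfun M \<phi> x u = L u"
  unfolding has_mderiv_def dfun_def by (simp add: frechet_derivative_eqI)

lemma tcoord_eq: "has_mderiv M (snd c) x L \<Longrightarrow> tcoord M c x u = L u"
  unfolding has_mderiv_def tcoord_def by (simp add: frechet_derivative_eqI)

lemma dmap_eq: "has_mderiv M (\<lambda>y. snd (chart_at B (f x)) (f y)) x L \<Longrightarrow> dmap M B f x u = L u"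
  unfolding has_mderiv_def dmap_def by (simp add: frechet_derivative_eqI o_def)

lemma has_mderiv_const: "has_mderiv M (\<lambda>y. k) x (\<lambda>u. 0)"
  unfolding has_mderiv_def by (simp add: o_def)

lemma has_mderiv_add:
  "has_mderiv M \<phi> x L \<Longrightarrow> has_mderiv M \<psi> x L' \<Longrightarrow> has_mderiv M (\<lambda>y. \<phi> y + \<psi> y) x (\<lambda>u. L u + L' u)"
  unfolding has_mderiv_def o_def by (rule has_derivative_add)

context
  fixes M :: "('m::{t2_space,second_countable_topology}, 'e::euclidean_space) chart set"
  assumes M: "smooth_manifold M"
begin

lemma has_mderiv_mult:
  fixes \<phi> \<psi> :: "'m \<Rightarrow> real"
  assumes "has_mderiv M \<phi> x L" "has_mderiv M \<psi> x L'"
  shows "has_mderiv M (\<lambda>y. \<phi> y * \<psi> y) x (\<lambda>u. \<phi> x * L' u + L u * \<psi> x)"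
  using has_derivative_mult[OF assms[unfolded has_mderiv_def]] chart_at_in[OF M, of x]
  unfolding has_mderiv_def o_def by (simp add: chart_inv_left[OF M])

lemma has_mderiv_cong:
  assumes "has_mderiv M \<phi> x L" "\<forall>\<^sub>F y in nhds x. \<phi> y = \<psi> y"
  shows "has_mderiv M \<psi> x L"
proof -
  let ?c = "chart_at M x"
  obtain W where W: "open W" "x \<in> W" "\<And>y. y \<in> W \<Longrightarrow> \<phi> y = \<psi> y"
    using assms(2) unfolding eventually_nhds by blast
  have "(\<phi> \<circ> chart_inv ?c) z = (\<psi> \<circ> chart_inv ?c) z" if "z \<in> snd ?c ` (W \<inter> fst ?c)" for z
    using that W(3) chart_at_in(1)[OF M] by (auto simp: chart_inv_left[OF M])
  then show ?thesis
    using has_derivative_cong_open[of "snd ?c ` (W \<inter> fst ?c)" "snd ?c x" "\<phi> \<circ> chart_inv ?c"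
        "\<psi> \<circ> chart_inv ?c" L] open_chart_image[OF M chart_at_in(1)[OF M] W(1), of x]
      chart_at_in[OF M, of x] W(2) assms(1)
    unfolding has_mderiv_def by blast
qed

lemma has_mderiv_compose:
  assumes "has_mderiv M \<phi> x L" "(h has_derivative H) (at (\<phi> x))"
  shows "has_mderiv M (\<lambda>y. h (\<phi> y)) x (\<lambda>u. H (L u))"
proof -
  have "(\<phi> \<circ> chart_inv (chart_at M x)) (snd (chart_at M x) x) = \<phi> x"
    using chart_at_in[OF M, of x] by (simp add: chart_inv_left[OF M])
  then show ?thesis
    using diff_chain_at[OF assms(1)[unfolded has_mderiv_def], of h H] assms(2)
    unfolding has_mderiv_def by (simp add: o_def)
qed

lemma has_mderiv_chart:
  assumes "c \<in> M" "x \<in> fst c"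
  shows "has_mderiv M (snd c) x (tcoord M c x)"
proof -
  let ?c = "chart_at M x"
  have "(snd c \<circ> chart_inv ?c) differentiable (at (snd ?c x))"
    using smooth_on_has_derivative[OF transition_smooth[OF M chart_at_in(1)[OF M] assms(1)], of "snd ?c x" x]
      chart_at_in[OF M, of x] assms(2) unfolding o_def differentiable_def by auto
  then show ?thesis
    unfolding has_mderiv_def frechet_derivative_works
    by (simp add: tcoord_def[abs_def])
qed

lemma tcoord_linear: "c \<in> M \<Longrightarrow> x \<in> fst c \<Longrightarrow> linear (tcoord M c x)"
  by (rule has_mderiv_linear[OF has_mderiv_chart])

text \<open>The definitions compute derivatives in the preferred chart at the point, which may jump from
  point to point. This lemma moves the computation to a fixed chart.\<close>

lemma has_mderiv_in_chart:
  assumes c: "c \<in> M" "x \<in> fst c" and H: "((\<lambda>z. \<phi> (chart_inv c z)) has_derivative H) (at (snd c x))"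
  shows "has_mderiv M \<phi> x (\<lambda>u. H (tcoord M c x u))"
proof (rule has_mderiv_cong[OF has_mderiv_compose[OF has_mderiv_chart[OF c] H]])
  show "\<forall>\<^sub>F y in nhds x. \<phi> (chart_inv c (snd c y)) = \<phi> y"
    unfolding eventually_nhds using open_chart[OF M c(1)] c chart_inv_left[OF M c(1)] by auto
qed

text \<open>The field with constant components \<open>w\<close> in the chart \<open>c\<close>. The formula is the change of
  components from \<open>c\<close> to the preferred chart at \<open>y\<close>, so it inverts \<open>tcoord M c y\<close>.\<close>

definition coord_field :: "('m, 'e) chart \<Rightarrow> 'e \<Rightarrow> 'm \<Rightarrow> 'e" where
  "coord_field c w y =
     frechet_derivative (\<lambda>z. snd (chart_at M y) (chart_inv c z)) (at (snd c y)) w"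

lemma
  assumes c: "c \<in> M" "x \<in> fst c"
  shows coord_field_linear: "linear (\<lambda>w. coord_field c w x)"
    and coord_field_tcoord: "coord_field c (tcoord M c x u) x = u"
    and tcoord_coord_field: "tcoord M c x (coord_field c w x) = w"
proof -
  let ?d = "chart_at M x"
  have d: "?d \<in> M" "x \<in> fst ?d" using chart_at_in[OF M] by auto
  have H: "((\<lambda>z. snd ?d (chart_inv c z)) has_derivative (\<lambda>w. coord_field c w x)) (at (snd c x))"
    using smooth_on_has_derivative[OF transition_smooth[OF M c(1) d(1)], of "snd c x"] c d
    unfolding coord_field_def[abs_def] by simp
  then show lin: "linear (\<lambda>w. coord_field c w x)" by (rule has_derivative_linear)
  \<comment> \<open>Both \<open>coord_field c (tcoord M c x u) x\<close> and \<open>u\<close> are the derivative of the preferred coordinates.\<close>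
  have "has_mderiv M (snd ?d) x (\<lambda>u. coord_field c (tcoord M c x u) x)"
    by (rule has_mderiv_in_chart[OF c H])
  moreover have "has_mderiv M (snd ?d) x (\<lambda>u. u)"
  proof -
    have "((\<lambda>z. z) has_derivative (\<lambda>u. u)) (at (snd ?d x))" by simp
    moreover have "z = (snd ?d \<circ> chart_inv ?d) z" if "z \<in> snd ?d ` (UNIV \<inter> fst ?d)" for z
      using that d(1) by (auto simp: chart_inv_left[OF M])
    ultimately show ?thesis
      using has_derivative_cong_open[of "snd ?d ` (UNIV \<inter> fst ?d)" "snd ?d x" "\<lambda>z. z"
          "snd ?d \<circ> chart_inv ?d" "\<lambda>u. u"] open_chart_image[OF M d(1) open_UNIV] d(2)
      unfolding has_mderiv_def by blast
  qed
  ultimately have left: "(\<lambda>u. coord_field c (tcoord M c x u) x) = (\<lambda>u. u)"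
    by (rule has_mderiv_unique)
  then show "coord_field c (tcoord M c x u) x = u" by (rule fun_cong)
  have "(\<lambda>w. coord_field c w x) \<circ> tcoord M c x = id" using left by (simp add: o_def id_def)
  then have "tcoord M c x \<circ> (\<lambda>w. coord_field c w x) = id"
    using linear_inverse_left[OF tcoord_linear[OF c] lin] by simp
  then show "tcoord M c x (coord_field c w x) = w" by (metis comp_apply id_apply)
qed

lemma tcoord_inject: "c \<in> M \<Longrightarrow> x \<in> fst c \<Longrightarrow> tcoord M c x u = tcoord M c x v \<Longrightarrow> u = v"
  using coord_field_tcoord by metis

lemma smooth_fun_has_mderiv:
  assumes "near x (\<lambda>U. smooth_fun M U \<phi>)"
  shows "has_mderiv M \<phi> x (dfun M \<phi> x)"
proof -
  obtain U where U: "open U" "x \<in> U" "smooth_fun M U \<phi>" using assms unfolding near_def by blast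
  let ?c = "chart_at M x"
  have "smooth_on (snd ?c ` (U \<inter> fst ?c)) (\<phi> \<circ> chart_inv ?c)"
    using U(3) chart_at_in[OF M] unfolding smooth_fun_def by blast
  from smooth_on_has_derivative[OF this, of "snd ?c x"] U(2) chart_at_in[OF M, of x]
  show ?thesis unfolding has_mderiv_def by (simp add: dfun_def[abs_def])
qed

lemma dfun_cong:
  assumes "\<forall>\<^sub>F y in nhds x. \<phi> y = \<psi> y"
  shows "dfun M \<phi> x u = dfun M \<psi> x u"
proof -
  have "\<forall>\<^sub>F y in nhds x. \<psi> y = \<phi> y" using assms by (simp add: eq_commute)
  then have "has_mderiv M \<phi> x = has_mderiv M \<psi> x"
    using assms has_mderiv_cong by blast
  then show ?thesis
    unfolding dfun_def frechet_derivative_def has_mderiv_def by metis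
qed

end

section \<open>Germs of functions and of sections along a map\<close>

lemma near_combine:
  assumes "near x P" "near x Q"
    and "\<And>U V. P U \<Longrightarrow> V \<subseteq> U \<Longrightarrow> P V" "\<And>U V. Q U \<Longrightarrow> V \<subseteq> U \<Longrightarrow> Q V"
    and "\<And>U. open U \<Longrightarrow> P U \<Longrightarrow> Q U \<Longrightarrow> R U"
  shows "near x R"
proof -
  obtain U V where "open U" "x \<in> U" "P U" "open V" "x \<in> V" "Q V"
    using assms(1,2) unfolding near_def by blast
  then have "open (U \<inter> V)" "x \<in> U \<inter> V" "P (U \<inter> V)" "Q (U \<inter> V)"
    using assms(3)[of U "U \<inter> V"] assms(4)[of V "U \<inter> V"] by auto
  then show ?thesis using assms(5) unfolding near_def by blast
qed

lemma near_mono: "near x P \<Longrightarrow> (\<And>U. open U \<Longrightarrow> P U \<Longrightarrow> Q U) \<Longrightarrow> near x Q"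
  unfolding near_def by blast

lemma near_eventually: "(\<forall>\<^sub>F y in nhds x. P y) = near x (\<lambda>U. \<forall>y\<in>U. P y)"
  unfolding eventually_nhds near_def by blast

lemma smooth_fun_subset: "smooth_fun M U \<phi> \<Longrightarrow> V \<subseteq> U \<Longrightarrow> smooth_fun M V \<phi>"
  unfolding smooth_fun_def by (meson Int_mono image_mono order_refl smooth_on_subset)

lemma smooth_along_subset: "smooth_along M B f U S \<Longrightarrow> V \<subseteq> U \<Longrightarrow> smooth_along M B f V S"
  unfolding smooth_along_def by (meson Int_mono image_mono order_refl smooth_on_subset)

context
  fixes M :: "('m::{t2_space,second_countable_topology}, 'e::euclidean_space) chart set"
  assumes M: "smooth_manifold M"
begin

lemma smooth_fun_cong:
  assumes "open U" "smooth_fun M U \<phi>" "\<And>y. y \<in> U \<Longrightarrow> \<phi> y = \<psi> y"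
  shows "smooth_fun M U \<psi>"
  unfolding smooth_fun_def
proof
  fix c assume c: "c \<in> M"
  have "(\<phi> \<circ> chart_inv c) z = (\<psi> \<circ> chart_inv c) z" if "z \<in> snd c ` (U \<inter> fst c)" for z
    using that c assms(3) by (auto simp: chart_inv_left[OF M])
  then show "smooth_on (snd c ` (U \<inter> fst c)) (\<psi> \<circ> chart_inv c)"
    using smooth_on_cong[OF open_chart_image[OF M c assms(1)], of "\<phi> \<circ> chart_inv c"]
      assms(2) c unfolding smooth_fun_def by blast
qed

lemma near_smooth_fun_cong:
  assumes "near x (\<lambda>U. smooth_fun M U \<phi>)" "\<forall>\<^sub>F y in nhds x. \<phi> y = \<psi> y"
  shows "near x (\<lambda>U. smooth_fun M U \<psi>)"
  by (rule near_combine[OF assms(1) assms(2)[unfolded near_eventually]])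
    (auto intro: smooth_fun_subset smooth_fun_cong)

lemma near_smooth_fun_const: "near x (\<lambda>U. smooth_fun M U (\<lambda>y. k))"
  unfolding near_def smooth_fun_def by (auto simp: o_def intro!: exI[of _ UNIV])

lemma near_smooth_fun_add:
  assumes "near x (\<lambda>U. smooth_fun M U \<phi>)" "near x (\<lambda>U. smooth_fun M U \<psi>)"
  shows "near x (\<lambda>U. smooth_fun M U (\<lambda>y. \<phi> y + \<psi> y))"
  by (rule near_combine[OF assms smooth_fun_subset smooth_fun_subset], assumption+)
    (auto simp: smooth_fun_def o_def intro!: smooth_on_add open_chart_image[OF M])

lemma near_smooth_fun_mult:
  assumes "near x (\<lambda>U. smooth_fun M U \<phi>)" "near x (\<lambda>U. smooth_fun M U \<psi>)"
  shows "near x (\<lambda>U. smooth_fun M U (\<lambda>y. \<phi> y * \<psi> y))"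
  by (rule near_combine[OF assms smooth_fun_subset smooth_fun_subset], assumption+)
    (auto simp: smooth_fun_def o_def real_scaleR_def[symmetric] simp del: real_scaleR_def
      intro!: smooth_on_scaleR open_chart_image[OF M])

lemma tcoord_change:
  assumes "c \<in> M" "y \<in> fst c" "d \<in> M" "y \<in> fst d"
  shows "tcoord M d y u = frechet_derivative (\<lambda>z. snd d (chart_inv c z)) (at (snd c y)) (tcoord M c y u)"
  by (rule tcoord_eq, rule has_mderiv_in_chart[OF M assms(1,2)],
      rule smooth_on_has_derivative[OF transition_smooth[OF M assms(1,3)]]) (use assms in auto)

lemma smooth_coord_field:
  assumes c: "c \<in> M"
  shows "smooth_vf M (fst c) (coord_field M c w)"
  unfolding smooth_along_def
proof (intro ballI)
  fix c1 c2 assume c12: "c1 \<in> M" "c2 \<in> M"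
  let ?S = "snd c1 ` (fst c \<inter> fst c1 \<inter> (\<lambda>x. x) -` fst c2)"
  let ?G = "\<lambda>z. frechet_derivative (\<lambda>z. snd c2 (chart_inv c z)) (at z) w"
  let ?t = "\<lambda>z. snd c (chart_inv c1 z)"
  have S: "open ?S"
    using open_chart_image[OF M c12(1), of "fst c \<inter> fst c2"] open_chart[OF M] c c12
    by (simp add: open_Int Int_ac)
  have sm: "smooth_on ?S (\<lambda>z. ?G (?t z))"
  proof (rule smooth_on_compose[OF S, where f = ?t and g = ?G])
    show "smooth_on ?S ?t"
      by (rule smooth_on_subset[OF transition_smooth[OF M c12(1) c]]) auto
    show "smooth_on (snd c ` (fst c \<inter> fst c2)) ?G"
      by (rule smooth_on_frechet_derivative[OF transition_smooth[OF M c c12(2)]])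
    show "?t ` ?S \<subseteq> snd c ` (fst c \<inter> fst c2)"
      using c12 by (auto simp: chart_inv_left[OF M])
  qed
  have eq: "tcoord M c2 (chart_inv c1 z) (coord_field M c w (chart_inv c1 z)) = ?G (?t z)"
    if "z \<in> ?S" for z
    using that c c12 tcoord_change[OF c _ c12(2)]
    by (auto simp: chart_inv_left[OF M] tcoord_coord_field[OF M c])
  show "smooth_on ?S
      (\<lambda>z. tcoord M c2 (chart_inv c1 z) (coord_field M c w (chart_inv c1 z)))"
      by (rule smooth_on_transfer[OF S sm eq[symmetric]])
qed

lemma near_coord_field:
  "c \<in> M \<Longrightarrow> x \<in> fst c \<Longrightarrow> near x (\<lambda>U. smooth_vf M U (coord_field M c w))"
  unfolding near_def using smooth_coord_field open_chart[OF M] by blast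

end

locale smooth_manifold_map =
  fixes M :: "('m::{t2_space,second_countable_topology}, 'e::euclidean_space) chart set"
    and B :: "('b::{t2_space,second_countable_topology}, 'd::euclidean_space) chart set"
    and f :: "'m \<Rightarrow> 'b"
  assumes M: "smooth_manifold M" and B: "smooth_manifold B" and f: "smooth_map M B f"
begin

abbreviation fun_at :: "'m \<Rightarrow> ('m \<Rightarrow> real) \<Rightarrow> bool" where
  "fun_at x \<phi> \<equiv> near x (\<lambda>U. smooth_fun M U \<phi>)"

abbreviation section_at :: "'m \<Rightarrow> ('m \<Rightarrow> 'd) \<Rightarrow> bool" where
  "section_at x V \<equiv> near x (\<lambda>U. smooth_along M B f U V)"

abbreviation "df \<equiv> dmap M B f"

lemma open_vimage_f: "open U \<Longrightarrow> open (f -` U)"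
  using f unfolding smooth_map_def by (simp add: open_vimage)

lemma open_dom:
  assumes "open U" "c \<in> M" "d \<in> B" shows "open (snd c ` (U \<inter> fst c \<inter> f -` fst d))"
  using open_chart_image[OF M assms(2), of "U \<inter> f -` fst d"] assms(1)
    open_vimage_f[OF open_chart[OF B assms(3)]]
  by (simp add: open_Int Int_ac)

lemma smooth_f:
  "c \<in> M \<Longrightarrow> d \<in> B \<Longrightarrow> smooth_on (snd c ` (fst c \<inter> f -` fst d)) (\<lambda>z. snd d (f (chart_inv c z)))"
  using f unfolding smooth_map_def o_def by blast

lemma smooth_f_on:
  "c \<in> M \<Longrightarrow> d \<in> B \<Longrightarrow> smooth_on (snd c ` (U \<inter> fst c \<inter> f -` fst d)) (\<lambda>z. snd d (f (chart_inv c z)))"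
  by (rule smooth_on_subset[OF smooth_f]) auto

lemma section_at_cong:
  assumes "section_at x V" "\<forall>\<^sub>F y in nhds x. V y = W y"
  shows "section_at x W"
proof (rule near_combine[OF assms(1) assms(2)[unfolded near_eventually]])
  fix U assume U: "open U" "smooth_along M B f U V" "\<forall>y\<in>U. V y = W y"
  show "smooth_along M B f U W"
    unfolding smooth_along_def
  proof (intro ballI)
    fix c d assume cd: "c \<in> M" "d \<in> B"
    let ?S = "snd c ` (U \<inter> fst c \<inter> f -` fst d)"
    have eq: "tcoord B d (f (chart_inv c z)) (V (chart_inv c z)) =
        tcoord B d (f (chart_inv c z)) (W (chart_inv c z))" if "z \<in> ?S" for z
      using that cd U(3) by (auto simp: chart_inv_left[OF M])
    have sm: "smooth_on ?S (\<lambda>z. tcoord B d (f (chart_inv c z)) (V (chart_inv c z)))"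
      using U(2) cd unfolding smooth_along_def by blast
    show "smooth_on ?S (\<lambda>z. tcoord B d (f (chart_inv c z)) (W (chart_inv c z)))"
      by (rule smooth_on_transfer[OF open_dom[OF U(1) cd] sm eq])
  qed
qed (auto intro: smooth_along_subset)

lemma section_at_add:
  assumes "section_at x V" "section_at x W"
  shows "section_at x (\<lambda>y. V y + W y)"
proof (rule near_combine[OF assms smooth_along_subset smooth_along_subset], assumption+)
  fix U assume U: "open U" "smooth_along M B f U V" "smooth_along M B f U W"
  show "smooth_along M B f U (\<lambda>y. V y + W y)"
    unfolding smooth_along_def
  proof (intro ballI)
    fix c d assume cd: "c \<in> M" "d \<in> B"
    let ?S = "snd c ` (U \<inter> fst c \<inter> f -` fst d)"
    let ?t = "\<lambda>V z. tcoord B d (f (chart_inv c z)) (V (chart_inv c z))"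
    have eq: "?t V z + ?t W z = ?t (\<lambda>y. V y + W y) z" if "z \<in> ?S" for z
      using that cd linear_add[OF tcoord_linear[OF B cd(2)]] by (auto simp: chart_inv_left[OF M])
    have sm: "smooth_on ?S (\<lambda>z. ?t V z + ?t W z)"
      by (rule smooth_on_add[OF open_dom[OF U(1) cd]])
        (use U cd in \<open>auto simp: smooth_along_def\<close>)
    show "smooth_on ?S (?t (\<lambda>y. V y + W y))"
      by (rule smooth_on_transfer[OF open_dom[OF U(1) cd] sm eq])
  qed
qed

lemma section_at_scale:
  assumes "fun_at x \<phi>" "section_at x V"
  shows "section_at x (\<lambda>y. \<phi> y *\<^sub>R V y)"
proof (rule near_combine[OF assms smooth_fun_subset smooth_along_subset], assumption+)
  fix U assume U: "open U" "smooth_fun M U \<phi>" "smooth_along M B f U V"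
  show "smooth_along M B f U (\<lambda>y. \<phi> y *\<^sub>R V y)"
    unfolding smooth_along_def
  proof (intro ballI)
    fix c d assume cd: "c \<in> M" "d \<in> B"
    let ?S = "snd c ` (U \<inter> fst c \<inter> f -` fst d)"
    let ?t = "\<lambda>V z. tcoord B d (f (chart_inv c z)) (V (chart_inv c z))"
    have eq: "\<phi> (chart_inv c z) *\<^sub>R ?t V z = ?t (\<lambda>y. \<phi> y *\<^sub>R V y) z" if "z \<in> ?S" for z
      using that cd linear_cmul[OF tcoord_linear[OF B cd(2)]] by (auto simp: chart_inv_left[OF M])
    have sm: "smooth_on ?S (\<lambda>z. \<phi> (chart_inv c z) *\<^sub>R ?t V z)"
    proof (rule smooth_on_scaleR[OF open_dom[OF U(1) cd]])
      show "smooth_on ?S (\<lambda>z. \<phi> (chart_inv c z))"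
        using U(2) cd(1) smooth_on_subset[of "snd c ` (U \<inter> fst c)" _ ?S]
        unfolding smooth_fun_def o_def by blast
    qed (use U cd in \<open>auto simp: smooth_along_def\<close>)
    show "smooth_on ?S (?t (\<lambda>y. \<phi> y *\<^sub>R V y))"
      by (rule smooth_on_transfer[OF open_dom[OF U(1) cd] sm eq])
  qed
qed

lemma section_at_restrict:
  assumes "near (f x) (\<lambda>U. smooth_vf B U Z)"
  shows "section_at x (\<lambda>y. Z (f y))"
proof -
  obtain U where U: "open U" "f x \<in> U" "smooth_vf B U Z" using assms unfolding near_def by blast
  have "smooth_along M B f (f -` U) (\<lambda>y. Z (f y))"
    unfolding smooth_along_def
  proof (intro ballI)
    fix c d assume cd: "c \<in> M" "d \<in> B"
    let ?S = "snd c ` (f -` U \<inter> fst c \<inter> f -` fst d)"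
    let ?G = "\<lambda>w. tcoord B d (chart_inv d w) (Z (chart_inv d w))"
    have sm: "smooth_on ?S (\<lambda>z. ?G (snd d (f (chart_inv c z))))"
    proof (rule smooth_on_compose[OF open_dom[OF open_vimage_f[OF U(1)] cd] smooth_f_on[OF cd]])
      show "smooth_on (snd d ` (U \<inter> fst d \<inter> (\<lambda>x. x) -` fst d)) ?G"
        using U(3) cd(2) unfolding smooth_along_def by blast
    qed (use cd in \<open>auto simp: chart_inv_left[OF M]\<close>)
    have eq: "?G (snd d (f (chart_inv c z))) = tcoord B d (f (chart_inv c z)) (Z (f (chart_inv c z)))"
      if "z \<in> ?S" for z
      using that cd by (auto simp: chart_inv_left[OF M] chart_inv_left[OF B])
    show "smooth_on ?S (\<lambda>z. tcoord B d (f (chart_inv c z)) (Z (f (chart_inv c z))))"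
      by (rule smooth_on_transfer[OF open_dom[OF open_vimage_f[OF U(1)] cd] sm eq])
  qed
  then show ?thesis using U open_vimage_f unfolding near_def by blast
qed

text \<open>The neighbourhood is cut down to the preimage of one chart domain of the target, in which \<open>\<psi>\<close>
  has a single coordinate expression to compose with.\<close>

lemma fun_at_restrict:
  assumes "near (f x) (\<lambda>U. smooth_fun B U \<psi>)"
  shows "fun_at x (\<lambda>y. \<psi> (f y))"
proof -
  obtain U where U: "open U" "f x \<in> U" "smooth_fun B U \<psi>" using assms unfolding near_def by blast
  obtain d where d: "d \<in> B" "f x \<in> fst d" using chart_at_in[OF B] by blast
  let ?W = "f -` U \<inter> f -` fst d"
  have W: "open ?W" using open_vimage_f U(1) open_chart[OF B d(1)] by blast
  have "smooth_fun M ?W (\<lambda>y. \<psi> (f y))"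
    unfolding smooth_fun_def o_def
  proof
    fix c assume c: "c \<in> M"
    let ?S = "snd c ` (?W \<inter> fst c)"
    have S: "open ?S" by (rule open_chart_image[OF M c W])
    have sm: "smooth_on ?S (\<lambda>z. (\<psi> \<circ> chart_inv d) (snd d (f (chart_inv c z))))"
    proof (rule smooth_on_compose[OF S, where g = "\<psi> \<circ> chart_inv d"])
      show "smooth_on ?S (\<lambda>z. snd d (f (chart_inv c z)))"
        by (rule smooth_on_subset[OF smooth_f[OF c d(1)]]) auto
      show "smooth_on (snd d ` (U \<inter> fst d)) (\<psi> \<circ> chart_inv d)"
        using U(3) d(1) unfolding smooth_fun_def by blast
    qed (use c in \<open>auto simp: chart_inv_left[OF M]\<close>)
    have eq: "(\<psi> \<circ> chart_inv d) (snd d (f (chart_inv c z))) = \<psi> (f (chart_inv c z))"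
      if "z \<in> ?S" for z
      using that c d by (auto simp: chart_inv_left[OF M] chart_inv_left[OF B])
    show "smooth_on ?S (\<lambda>z. \<psi> (f (chart_inv c z)))"
      by (rule smooth_on_transfer[OF S sm eq])
  qed
  then show ?thesis using U(2) d(2) W unfolding near_def by blast
qed

lemma has_mderiv_chain:
  assumes "has_mderiv B \<psi> (f x) L"
  shows "has_mderiv M (\<lambda>y. \<psi> (f y)) x (\<lambda>u. L (df x u))"
proof -
  let ?c = "chart_at M x" and ?d = "chart_at B (f x)"
  have cd: "?c \<in> M" "x \<in> fst ?c" "?d \<in> B" "f x \<in> fst ?d"
    using chart_at_in[OF M] chart_at_in[OF B] by auto
  have "((\<lambda>z. snd ?d (f (chart_inv ?c z))) has_derivative
      frechet_derivative (\<lambda>z. snd ?d (f (chart_inv ?c z))) (at (snd ?c x))) (at (snd ?c x))"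
    by (rule smooth_on_has_derivative[OF smooth_f[OF cd(1,3)]]) (use cd in auto)
  then have "has_mderiv M (\<lambda>y. snd ?d (f y)) x (df x)"
    unfolding has_mderiv_def by (simp add: o_def dmap_def[abs_def])
  from has_mderiv_compose[OF M this assms[unfolded has_mderiv_def]]
  have "has_mderiv M (\<lambda>y. (\<psi> \<circ> chart_inv ?d) (snd ?d (f y))) x (\<lambda>u. L (df x u))" .
  then show ?thesis
  proof (rule has_mderiv_cong[OF M])
    show "\<forall>\<^sub>F y in nhds x. (\<psi> \<circ> chart_inv ?d) (snd ?d (f y)) = \<psi> (f y)"
      unfolding eventually_nhds
      by (rule exI[of _ "f -` fst ?d"])
        (use cd open_vimage_f open_chart[OF B] in \<open>auto simp: chart_inv_left[OF B]\<close>)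
  qed
qed

lemma dmap_linear: "linear (df x)"
proof -
  let ?d = "chart_at B (f x)"
  have "has_mderiv M (\<lambda>y. snd ?d (f y)) x (\<lambda>u. tcoord B ?d (f x) (df x u))"
    using has_mderiv_chain[OF has_mderiv_chart[OF B chart_at_in[OF B]]] .
  from has_mderiv_linear[OF this] dmap_eq[OF this] show ?thesis
    by (metis (no_types, lifting) ext)
qed

lemma dfun_restrict:
  assumes "near (f x) (\<lambda>U. smooth_fun B U \<psi>)"
  shows "dfun M (\<lambda>y. \<psi> (f y)) x u = dfun B \<psi> (f x) (df x u)"
  by (rule dfun_eq[OF has_mderiv_chain[OF smooth_fun_has_mderiv[OF B assms]]])

lemma dfun_coordinate:
  assumes "d \<in> B" "f x \<in> fst d"
  shows "dfun M (\<lambda>y. snd d (f y) \<bullet> b) x u = tcoord B d (f x) (df x u) \<bullet> b"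
  by (rule dfun_eq[OF has_mderiv_compose[OF M has_mderiv_chain[OF has_mderiv_chart[OF B assms]]]])
    (rule bounded_linear_imp_has_derivative[OF bounded_linear_inner_left])

lemma fun_at_coordinate:
  assumes d: "d \<in> B" "f x \<in> fst d"
  shows "fun_at x (\<lambda>y. snd d (f y) \<bullet> b)"
  unfolding near_def smooth_fun_def o_def
proof (intro exI[of _ "f -` fst d"] conjI ballI)
  show W: "open (f -` fst d)" by (rule open_vimage_f[OF open_chart[OF B d(1)]])
  show "x \<in> f -` fst d" using d by simp
  fix c assume c: "c \<in> M"
  show "smooth_on (snd c ` (f -` fst d \<inter> fst c)) (\<lambda>z. snd d (f (chart_inv c z)) \<bullet> b)"
    by (rule smooth_on_inner_const[OF open_chart_image[OF M c W]])
      (rule smooth_on_subset[OF smooth_f[OF c d(1)]], auto)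
qed

lemma fun_at_component:
  assumes "section_at x V" and d: "d \<in> B" "f x \<in> fst d"
  shows "fun_at x (\<lambda>y. tcoord B d (f y) (V y) \<bullet> b)"
proof -
  obtain U where U: "open U" "x \<in> U" "smooth_along M B f U V"
    using assms(1) unfolding near_def by blast
  let ?W = "U \<inter> f -` fst d"
  have W: "open ?W" using U(1) open_vimage_f[OF open_chart[OF B d(1)]] by blast
  have "smooth_on (snd c ` (?W \<inter> fst c))
      (\<lambda>z. tcoord B d (f (chart_inv c z)) (V (chart_inv c z)) \<bullet> b)" if c: "c \<in> M" for c
    by (rule smooth_on_inner_const[OF open_chart_image[OF M c W]])
      (use U(3) c d(1) in \<open>auto simp: smooth_along_def Int_ac\<close>)
  then show ?thesis
    using W U(2) d(2) unfolding near_def smooth_fun_def o_def by blast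
qed

text \<open>In charts \<open>f\<^sub>*Y\<close> is the Jacobian of \<open>f\<close> applied to the components of \<open>Y\<close>.\<close>

lemma section_at_push_forward:
  assumes "near x (\<lambda>U. smooth_vf M U Y)"
  shows "section_at x (\<lambda>y. df y (Y y))"
proof (rule near_mono[OF assms])
  fix U assume U: "open U" "smooth_vf M U Y"
  show "smooth_along M B f U (\<lambda>y. df y (Y y))"
    unfolding smooth_along_def
  proof (intro ballI)
    fix c d assume cd: "c \<in> M" "d \<in> B"
    let ?S = "snd c ` (U \<inter> fst c \<inter> f -` fst d)"
    let ?F = "\<lambda>z. snd d (f (chart_inv c z))"
    have sm: "smooth_on ?S (\<lambda>z. frechet_derivative ?F (at z) (tcoord M c (chart_inv c z) (Y (chart_inv c z))))"
    proof (rule smooth_on_frechet_derivative_apply[OF open_dom[OF U(1) cd] smooth_f_on[OF cd]])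
      have "smooth_on (snd c ` (U \<inter> fst c \<inter> (\<lambda>x. x) -` fst c))
          (\<lambda>z. tcoord M c (chart_inv c z) (Y (chart_inv c z)))"
        using U(2) cd(1) unfolding smooth_along_def by blast
      then show "smooth_on ?S (\<lambda>z. tcoord M c (chart_inv c z) (Y (chart_inv c z)))"
        by (rule smooth_on_subset) auto
    qed
    have eq: "frechet_derivative ?F (at z) (tcoord M c (chart_inv c z) (Y (chart_inv c z))) =
        tcoord B d (f (chart_inv c z)) (df (chart_inv c z) (Y (chart_inv c z)))" if z: "z \<in> ?S" for z
    proof -
      obtain y where y: "y \<in> U" "y \<in> fst c" "f y \<in> fst d" "z = snd c y" using z by auto
      have "has_mderiv M (\<lambda>y. snd d (f y)) y (\<lambda>u. frechet_derivative ?F (at (snd c y)) (tcoord M c y u))"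
        by (rule has_mderiv_in_chart[OF M cd(1) y(2)], rule smooth_on_has_derivative[OF smooth_f[OF cd]])
          (use y in auto)
      from has_mderiv_unique[OF this has_mderiv_chain[OF has_mderiv_chart[OF B cd(2) y(3)]]]
      show ?thesis using y cd by (auto simp: chart_inv_left[OF M] dest: fun_cong)
    qed
    show "smooth_on ?S
        (\<lambda>z. tcoord B d (f (chart_inv c z)) (df (chart_inv c z) (Y (chart_inv c z))))"
      by (rule smooth_on_transfer[OF open_dom[OF U(1) cd] sm eq])
  qed
qed

lemma frame_expansion:
  assumes d: "d \<in> B" "y \<in> fst d"
  shows "v = (\<Sum>b\<in>Basis. (tcoord B d y v \<bullet> b) *\<^sub>R coord_field B d b y)"
proof -
  note lin = coord_field_linear[OF B d]
  have "v = coord_field B d (\<Sum>b\<in>Basis. (tcoord B d y v \<bullet> b) *\<^sub>R b) y"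
    by (simp only: euclidean_representation coord_field_tcoord[OF B d])
  then show ?thesis by (simp only: linear_sum[OF lin] linear_cmul[OF lin])
qed

lemma section_expansion:
  assumes d: "d \<in> B" "f x \<in> fst d"
  shows "\<forall>\<^sub>F y in nhds x.
    (\<Sum>b\<in>Basis. (tcoord B d (f y) (V y) \<bullet> b) *\<^sub>R coord_field B d b (f y)) = V y"
  unfolding eventually_nhds
  using open_vimage_f[OF open_chart[OF B d(1)]] d frame_expansion[OF d(1)]
  by (intro exI[of _ "f -` fst d"]) auto

text \<open>Every section along \<open>f\<close> is near \<open>x\<close> a combination, with smooth coefficients, of the
  restrictions to \<open>f\<close> of a coordinate frame of the target. So a local property that is stable under
  such combinations needs to be checked on restrictions of ambient fields only, where it is a
  statement about the ambient manifold.\<close>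

lemma section_induct [consumes 1, case_names cong add scale restrict]:
  assumes V: "section_at x V"
    and cong: "\<And>V W. section_at x V \<Longrightarrow> P V \<Longrightarrow> \<forall>\<^sub>F y in nhds x. V y = W y \<Longrightarrow> P W"
    and add: "\<And>V W. section_at x V \<Longrightarrow> section_at x W \<Longrightarrow> P V \<Longrightarrow> P W \<Longrightarrow> P (\<lambda>y. V y + W y)"
    and scale: "\<And>\<phi> V. fun_at x \<phi> \<Longrightarrow> section_at x V \<Longrightarrow> P V \<Longrightarrow> P (\<lambda>y. \<phi> y *\<^sub>R V y)"
    and restrict: "\<And>Z. near (f x) (\<lambda>U. smooth_vf B U Z) \<Longrightarrow> P (\<lambda>y. Z (f y))"
  shows "P V"
proof -
  obtain d where d: "d \<in> B" "f x \<in> fst d" using chart_at_in[OF B] by blast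
  let ?v = "\<lambda>b y. tcoord B d (f y) (V y) \<bullet> b" and ?E = "\<lambda>b y. coord_field B d b (f y)"
  have E: "section_at x (?E b)" "P (?E b)" for b
    using section_at_restrict restrict near_coord_field[OF B d] by blast+
  have v: "fun_at x (?v b)" for b by (rule fun_at_component[OF V d])
  have vE: "section_at x (\<lambda>y. ?v b y *\<^sub>R ?E b y)" "P (\<lambda>y. ?v b y *\<^sub>R ?E b y)" for b
    using section_at_scale[OF v E(1)] scale[OF v E] .
  have zero: "section_at x (\<lambda>y. 0)" "P (\<lambda>y. 0)"
    using section_at_scale[OF near_smooth_fun_const[OF M] E(1), of 0]
      scale[OF near_smooth_fun_const[OF M] E, of 0] by simp_all
  have "section_at x (\<lambda>y. \<Sum>b\<in>I. ?v b y *\<^sub>R ?E b y) \<and> P (\<lambda>y. \<Sum>b\<in>I. ?v b y *\<^sub>R ?E b y)"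
    if "finite I" for I
    using that
  proof (induction I)
    case (insert b I)
    then show ?case using add[OF vE(1) _ vE(2)] section_at_add[OF vE(1)] by simp
  qed (use zero in simp)
  from this[OF finite_Basis] show ?thesis
    using cong[OF _ _ section_expansion[OF d]] by blast
qed

end

section \<open>The pullback connection inherits the properties of the ambient one\<close>

text \<open>A coordinate field differentiates a coordinate function to a constant, so the bracket of two
  coordinate fields kills all coordinate functions; torsion freeness identifies this bracket with the
  difference of the two sides.\<close>

lemma coord_field_commute:
  fixes B :: "('b::{t2_space,second_countable_topology}, 'd::euclidean_space) chart set"
  assumes B: "smooth_manifold B" and tf: "torsion_free B nabla" and d: "d \<in> B" "q \<in> fst d"
  shows "nabla q (coord_field B d v q) (coord_field B d w) = nabla q (coord_field B d w q) (coord_field B d v)"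
proof -
  let ?E = "coord_field B d"
  let ?T = "nabla q (?E v q) (?E w) - nabla q (?E w q) (?E v)"
  have coord: "has_mderiv B (\<lambda>y. snd d y \<bullet> b) y (\<lambda>u. tcoord B d y u \<bullet> b)" if "y \<in> fst d" for y b
    by (rule has_mderiv_compose[OF B has_mderiv_chart[OF B d(1) that]])
      (rule bounded_linear_imp_has_derivative[OF bounded_linear_inner_left])
  have smooth: "near q (\<lambda>U. smooth_fun B U (\<lambda>y. snd d y \<bullet> b))" for b
    unfolding near_def smooth_fun_def o_def
  proof (intro exI[of _ "fst d"] conjI ballI)
    show "open (fst d)" "q \<in> fst d" using open_chart[OF B] d by auto
    fix c assume c: "c \<in> B"
    show "smooth_on (snd c ` (fst d \<inter> fst c)) (\<lambda>z. snd d (chart_inv c z) \<bullet> b)"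
      by (rule smooth_on_inner_const[OF open_chart_image[OF B c open_chart[OF B d(1)]]])
        (use transition_smooth[OF B c d(1)] in \<open>simp add: Int_commute\<close>)
  qed
  have const: "dfun B (\<lambda>y. dfun B (\<lambda>y. snd d y \<bullet> b) y (?E w y)) q u = 0" for b w u
  proof (rule dfun_eq[OF has_mderiv_cong[OF B has_mderiv_const]])
    show "\<forall>\<^sub>F y in nhds q. w \<bullet> b = dfun B (\<lambda>y. snd d y \<bullet> b) y (?E w y)"
      unfolding eventually_nhds using open_chart[OF B d(1)] d
      by (intro exI[of _ "fst d"]) (auto simp: dfun_eq[OF coord] tcoord_coord_field[OF B d(1)])
  qed
  have "tcoord B d q ?T \<bullet> b = 0" for b
    using tf near_coord_field[OF B d] smooth[of b] dfun_eq[OF coord[OF d(2), of b], of ?T]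
    unfolding torsion_free_def by (simp add: const)
  then have "tcoord B d q ?T = tcoord B d q 0"
    using linear_0[OF tcoord_linear[OF B d]] by (simp add: euclidean_eq_iff[where 'a = 'd])
  then show ?thesis using tcoord_inject[OF B d] by fastforce
qed

locale pullback = smooth_manifold_map M B f
  for M :: "('m::{t2_space,second_countable_topology}, 'e::euclidean_space) chart set"
    and B :: "('b::{t2_space,second_countable_topology}, 'd::euclidean_space) chart set"
    and f :: "'m \<Rightarrow> 'b" +
  fixes nablaB :: "'b \<Rightarrow> 'd \<Rightarrow> ('b \<Rightarrow> 'd) \<Rightarrow> 'd"
    and D :: "'m \<Rightarrow> 'e \<Rightarrow> ('m \<Rightarrow> 'd) \<Rightarrow> 'd"
  assumes D: "pullback_connection M B f nablaB D"
begin

lemma D_add: "section_at x V \<Longrightarrow> section_at x W \<Longrightarrow> D x u (\<lambda>y. V y + W y) = D x u V + D x u W"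
  using D unfolding pullback_connection_def connection_along_def by presburger

lemma D_scale:
  "fun_at x \<phi> \<Longrightarrow> section_at x V \<Longrightarrow>
    D x u (\<lambda>y. \<phi> y *\<^sub>R V y) = dfun M \<phi> x u *\<^sub>R V x + \<phi> x *\<^sub>R D x u V"
  using D unfolding pullback_connection_def connection_along_def by presburger

lemma D_restrict:
  "near (f x) (\<lambda>U. smooth_vf B U Z) \<Longrightarrow> D x u (\<lambda>y. Z (f y)) = nablaB (f x) (df x u) Z"
  using D unfolding pullback_connection_def by blast

text \<open>The indicator function \<open>\<chi>\<close> of a neighbourhood of \<open>x\<close> is smooth near \<open>x\<close> with zero derivative, so
  the Leibniz rule gives \<open>D(\<chi>V) = DV\<close> at \<open>x\<close>; and \<open>\<chi>V\<close> and \<open>\<chi>W\<close> are equal everywhere.\<close>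

lemma D_local:
  assumes V: "section_at x V" and VW: "\<forall>\<^sub>F y in nhds x. V y = W y"
  shows "D x u V = D x u W"
proof -
  obtain A where A: "open A" "x \<in> A" "\<And>y. y \<in> A \<Longrightarrow> V y = W y"
    using VW unfolding eventually_nhds by blast
  let ?\<chi> = "indicat_real A"
  have ev: "\<forall>\<^sub>F y in nhds x. 1 = ?\<chi> y"
    unfolding eventually_nhds using A by (intro exI[of _ A]) auto
  have \<chi>: "fun_at x ?\<chi>" by (rule near_smooth_fun_cong[OF M near_smooth_fun_const[OF M] ev])
  have d\<chi>: "dfun M ?\<chi> x u = 0"
    by (rule dfun_eq[OF has_mderiv_cong[OF M has_mderiv_const ev]])
  have eq: "(\<lambda>y. ?\<chi> y *\<^sub>R V y) = (\<lambda>y. ?\<chi> y *\<^sub>R W y)"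
    using A(3) by (intro ext) (simp add: indicator_def of_bool_def)
  show ?thesis
    using D_scale[OF \<chi> V, of u] D_scale[OF \<chi> section_at_cong[OF V VW], of u] A(2) d\<chi> eq by simp
qed

lemma section_at_sum_and_D_sum:
  assumes "finite I" "\<And>i. i \<in> I \<Longrightarrow> fun_at x (\<phi> i)" "\<And>i. i \<in> I \<Longrightarrow> section_at x (V i)"
  shows "section_at x (\<lambda>y. \<Sum>i\<in>I. \<phi> i y *\<^sub>R V i y) \<and>
    D x u (\<lambda>y. \<Sum>i\<in>I. \<phi> i y *\<^sub>R V i y) =
      (\<Sum>i\<in>I. dfun M (\<phi> i) x u *\<^sub>R V i x + \<phi> i x *\<^sub>R D x u (V i))"
  using assms
proof (induction I)
  case empty
  have z: "section_at x (\<lambda>y. 0)"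
    unfolding near_def smooth_along_def
  proof (intro exI[of _ UNIV] conjI ballI)
    fix c d assume cd: "c \<in> M" "d \<in> B"
    have "tcoord B d (f (chart_inv c z)) 0 = 0"
      if "z \<in> snd c ` (UNIV \<inter> fst c \<inter> f -` fst d)" for z
      using that cd linear_0[OF tcoord_linear[OF B cd(2)]] by (auto simp: chart_inv_left[OF M])
    from smooth_on_transfer[OF open_dom[OF open_UNIV cd] smooth_on_const this[symmetric]]
    show "smooth_on (snd c ` (UNIV \<inter> fst c \<inter> f -` fst d)) (\<lambda>z. tcoord B d (f (chart_inv c z)) 0)" .
  qed auto
  then show ?case using D_add[OF z z, of u] by simp
next
  case (insert i I)
  then have i: "fun_at x (\<phi> i)" "section_at x (V i)" by auto
  show ?case
    using insert D_add[OF section_at_scale[OF i]] section_at_add[OF section_at_scale[OF i]] D_scale[OF i]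
    by simp
qed

lemma D_frame:
  assumes V: "section_at x V" and d: "d \<in> B" "f x \<in> fst d"
  shows "D x u V = (\<Sum>b\<in>Basis. dfun M (\<lambda>y. tcoord B d (f y) (V y) \<bullet> b) x u *\<^sub>R coord_field B d b (f x)
      + (tcoord B d (f x) (V x) \<bullet> b) *\<^sub>R nablaB (f x) (df x u) (coord_field B d b))"
proof -
  let ?v = "\<lambda>b y. tcoord B d (f y) (V y) \<bullet> b" and ?E = "\<lambda>b y. coord_field B d b (f y)"
  note E = section_at_restrict[OF near_coord_field[OF B d]]
  note S = section_at_sum_and_D_sum[OF finite_Basis fun_at_component[OF V d] E]
  have "D x u V = D x u (\<lambda>y. \<Sum>b\<in>Basis. ?v b y *\<^sub>R ?E b y)"
    using D_local[OF conjunct1[OF S] section_expansion[OF d]] by simp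
  then show ?thesis
    by (simp only: conjunct2[OF S] D_restrict[OF near_coord_field[OF B d]])
qed

text \<open>In a coordinate frame \<open>E\<^sub>b\<close> of the target, \<open>D\<^sub>X (f\<^sub>*Y)\<close> is the sum of \<open>X(Y f\<^sup>b) E\<^sub>b\<close> and of
  \<open>(Y f\<^sup>b) (X f\<^sup>a) \<nabla>\<^sub>a E\<^sub>b\<close>.  The second sum is symmetric in \<open>X\<close> and \<open>Y\<close> by \<open>coord_field_commute\<close>.
  Torsion freeness on \<open>M\<close>, tested on the coordinate functions \<open>f\<^sup>b\<close> of the map, evaluates the
  antisymmetric part of the first: \<open>X(Y f\<^sup>b) - Y(X f\<^sup>b)\<close> is the derivative of \<open>f\<^sup>b\<close> along
  \<open>\<nabla>\<^sub>X Y - \<nabla>\<^sub>Y X\<close>.\<close>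

lemma pullback_torsion_free:
  assumes tf: "torsion_free M nabla" and tfB: "torsion_free B nablaB"
    and conn: "affine_connection B nablaB"
    and X: "near x (\<lambda>U. smooth_vf M U X)" and Y: "near x (\<lambda>U. smooth_vf M U Y)"
  shows "D x (X x) (\<lambda>y. df y (Y y)) - D x (Y x) (\<lambda>y. df y (X y))
    = df x (nabla x (X x) Y - nabla x (Y x) X)"
proof -
  obtain d where d: "d \<in> B" "f x \<in> fst d" using chart_at_in[OF B] by blast
  let ?E = "\<lambda>b. coord_field B d b"
  let ?c = "\<lambda>X b y. tcoord B d (f y) (df y (X y)) \<bullet> b"
  let ?T = "nabla x (X x) Y - nabla x (Y x) X"
  have coeff: "dfun M (\<lambda>y. dfun M (\<lambda>y. snd d (f y) \<bullet> b) y (X y)) x u = dfun M (?c X b) x u" for X b u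
  proof (rule dfun_cong[OF M])
    show "\<forall>\<^sub>F y in nhds x. dfun M (\<lambda>y. snd d (f y) \<bullet> b) y (X y) = ?c X b y"
      unfolding eventually_nhds using d open_vimage_f[OF open_chart[OF B d(1)]]
      by (intro exI[of _ "f -` fst d"]) (auto simp: dfun_coordinate)
  qed
  have "tcoord B d (f x) (df x ?T) \<bullet> b = dfun M (?c Y b) x (X x) - dfun M (?c X b) x (Y x)" for b
    using tf X Y fun_at_coordinate[OF d, of b] dfun_coordinate[OF d, of b ?T]
    unfolding torsion_free_def by (simp add: coeff)
  then have first: "df x ?T =
      (\<Sum>b\<in>Basis. (dfun M (?c Y b) x (X x) - dfun M (?c X b) x (Y x)) *\<^sub>R ?E b (f x))"
    using frame_expansion[OF d, of "df x ?T"] by simp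
  have expand: "(\<Sum>b\<in>Basis. ?c Y b x *\<^sub>R nablaB (f x) (df x (X x)) (?E b)) =
      (\<Sum>b\<in>Basis. \<Sum>a\<in>Basis. (?c Y b x * ?c X a x) *\<^sub>R nablaB (f x) (?E a (f x)) (?E b))" for X Y
  proof (rule sum.cong[OF refl])
    fix b :: 'd
    have lin: "linear (\<lambda>u. nablaB (f x) u (?E b))"
      using conn near_coord_field[OF B d] unfolding connection_along_def by presburger
    have "nablaB (f x) (df x (X x)) (?E b) =
        nablaB (f x) (\<Sum>a\<in>Basis. ?c X a x *\<^sub>R ?E a (f x)) (?E b)"
      using frame_expansion[OF d, of "df x (X x)"] by simp
    then show "?c Y b x *\<^sub>R nablaB (f x) (df x (X x)) (?E b) =
        (\<Sum>a\<in>Basis. (?c Y b x * ?c X a x) *\<^sub>R nablaB (f x) (?E a (f x)) (?E b))"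
      by (simp add: linear_sum[OF lin] linear_cmul[OF lin] scaleR_sum_right)
  qed
  have second: "(\<Sum>b\<in>Basis. ?c Y b x *\<^sub>R nablaB (f x) (df x (X x)) (?E b)) =
      (\<Sum>b\<in>Basis. ?c X b x *\<^sub>R nablaB (f x) (df x (Y x)) (?E b))"
  proof -
    have "(\<Sum>b\<in>Basis. \<Sum>a\<in>Basis. (?c Y b x * ?c X a x) *\<^sub>R nablaB (f x) (?E a (f x)) (?E b)) =
        (\<Sum>a\<in>Basis. \<Sum>b\<in>Basis. (?c X a x * ?c Y b x) *\<^sub>R nablaB (f x) (?E b (f x)) (?E a))"
      by (subst sum.swap) (intro sum.cong refl arg_cong2[where f = scaleR] mult.commute
          coord_field_commute[OF B tfB d])
    then show ?thesis unfolding expand .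
  qed
  note frame = D_frame[OF section_at_push_forward d]
  show ?thesis
    unfolding frame[OF X] frame[OF Y] first using second
    by (simp add: sum.distrib scaleR_diff_left sum_subtractf)
qed

text \<open>Both sides are biadditive and obey the same Leibniz rule in each argument. By section induction in
  \<open>V\<close> and then in \<open>W\<close> the claim reduces to two restrictions of ambient fields, where it is the chain
  rule together with the metric property of the ambient connection. The induction also carries the
  smoothness of the inner product, on which the Leibniz rule for \<open>dfun\<close> depends.\<close>

lemma pullback_metric:
  assumes g: "riemannian_metric B g" and met: "metric_connection B g nablaB"
    and V: "section_at x V" and W: "section_at x W"
  shows "fun_at x (\<lambda>y. g (f y) (V y) (W y)) \<and>
    dfun M (\<lambda>y. g (f y) (V y) (W y)) x u = g (f x) (D x u V) (W x) + g (f x) (V x) (D x u W)"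
    (is "?Q V W")
proof -
  have bil: "bilinear (g q)" and sym: "g q a b = g q b a" for q a b
    using g unfolding riemannian_metric_def by blast+
  note lin = bilinear_ladd[OF bil] bilinear_lmul[OF bil]
  have Qsym: "?Q V W" if "?Q W V" for V W
    using that by (simp add: sym add.commute)
  have Qcong: "?Q V' W" if "section_at x V" "\<forall>\<^sub>F y in nhds x. V y = V' y" "?Q V W" for V V' W
  proof -
    have ev: "\<forall>\<^sub>F y in nhds x. g (f y) (V y) (W y) = g (f y) (V' y) (W y)"
      using that(2) by (rule eventually_mono) simp
    have "V x = V' x" using that(2) by (rule eventually_nhds_x_imp_x)
    then show ?thesis
      using that(3) near_smooth_fun_cong[OF M _ ev] dfun_cong[OF M ev, of u] D_local[OF that(1,2)] by simp
  qed
  have Qadd: "?Q (\<lambda>y. V y + V' y) W"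
    if "section_at x V" "section_at x V'" "?Q V W" "?Q V' W" for V V' W
    using that near_smooth_fun_add[OF M] D_add[OF that(1,2), of u]
      dfun_eq[OF has_mderiv_add[OF smooth_fun_has_mderiv[OF M] smooth_fun_has_mderiv[OF M]], of x
        "\<lambda>y. g (f y) (V y) (W y)" "\<lambda>y. g (f y) (V' y) (W y)" u]
    by (simp add: lin)
  have Qscale: "?Q (\<lambda>y. \<phi> y *\<^sub>R V y) W" if "fun_at x \<phi>" "section_at x V" "?Q V W" for \<phi> V W
    using that near_smooth_fun_mult[OF M that(1) conjunct1[OF that(3)]] D_scale[OF that(1,2), of u]
      dfun_eq[OF has_mderiv_mult[OF M smooth_fun_has_mderiv[OF M that(1)] smooth_fun_has_mderiv[OF M]],
        of "\<lambda>y. g (f y) (V y) (W y)" u]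
    by (simp add: lin algebra_simps)
  have Qrestrict: "?Q (\<lambda>y. Z (f y)) (\<lambda>y. Z' (f y))"
    if Z: "near (f x) (\<lambda>U. smooth_vf B U Z)" and Z': "near (f x) (\<lambda>U. smooth_vf B U Z')" for Z Z'
  proof -
    have n: "near (f x) (\<lambda>U. smooth_fun B U (\<lambda>q. g q (Z q) (Z' q)))"
      by (rule near_combine[OF Z Z' smooth_along_subset smooth_along_subset], assumption+)
        (use g in \<open>auto simp: riemannian_metric_def\<close>)
    show ?thesis
      using fun_at_restrict[OF n] dfun_restrict[OF n, of u] met Z Z' D_restrict
      unfolding metric_connection_def by simp
  qed
  from V show ?thesis
  proof (induction rule: section_induct)
    case (restrict Z)
    from W have "?Q W (\<lambda>y. Z (f y))"
    proof (induction rule: section_induct)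
      case (cong V W)
      then show ?case by (rule Qcong)
    next
      case (add V W)
      then show ?case by (rule Qadd)
    next
      case (scale \<phi> V)
      then show ?case by (rule Qscale)
    next
      case (restrict Z')
      then show ?case using \<open>near (f x) (\<lambda>U. smooth_vf B U Z)\<close> by (rule Qrestrict)
    qed
    then show ?case by (rule Qsym)
  next
    case (cong V W')
    then show ?case by (rule Qcong)
  next
    case (add V V')
    then show ?case by (rule Qadd)
  next
    case (scale \<phi> V)
    then show ?case by (rule Qscale)
  qed
qed

text \<open>Both \<open>D \<circ> J\<close> and \<open>J \<circ> D\<close> obey the Leibniz rule of a connection, with \<open>J\<close> applied to the
  section in the derivative term, so they agree once they agree on restrictions of ambient fields;
  there this is \<open>\<nabla>J = 0\<close>.\<close>

lemma pullback_parallel: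
  assumes J: "tensor_field_11 B J"
    and par: "\<And>q w Z. near q (\<lambda>U. smooth_vf B U Z) \<Longrightarrow> cov_deriv_11 nablaB J q w Z = 0"
    and V: "section_at x V"
  shows "section_at x (\<lambda>y. J (f y) (V y)) \<and> D x u (\<lambda>y. J (f y) (V y)) = J (f x) (D x u V)"
proof -
  have lin: "linear (J q)" for q using J unfolding tensor_field_11_def by blast
  from V show ?thesis
  proof (induction rule: section_induct)
    case (cong V W)
    from cong(2) have ev: "\<forall>\<^sub>F y in nhds x. J (f y) (V y) = J (f y) (W y)"
      by (rule eventually_mono) simp
    then show ?case
      using cong section_at_cong[OF _ ev] D_local[OF _ ev, of u] D_local[OF cong(1,2), of u] by simp
  next
    case (add V W)
    then show ?case
      using section_at_add D_add by (simp add: linear_add[OF lin])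
  next
    case (scale \<phi> V)
    then show ?case
      using section_at_scale D_scale by (simp add: linear_add[OF lin] linear_cmul[OF lin])
  next
    case (restrict Z)
    have "near (f x) (\<lambda>U. smooth_vf B U (\<lambda>q. J q (Z q)))"
      by (rule near_mono[OF restrict]) (use J in \<open>auto simp: tensor_field_11_def\<close>)
    from section_at_restrict[OF this] D_restrict[OF this, of u] par[OF restrict, of "df x u"]
      D_restrict[OF restrict, of u]
    show ?case unfolding cov_deriv_11_def by simp
  qed
qed

end

section \<open>The Gauss formula and normal frames\<close>

locale riemannian_immersion = pullback M B f nablaB D
  for M :: "('m::{t2_space,second_countable_topology}, 'e::euclidean_space) chart set"
    and B :: "('b::{t2_space,second_countable_topology}, 'd::euclidean_space) chart set"
    and f :: "'m \<Rightarrow> 'b" and nablaB D +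
  fixes gM :: "'m \<Rightarrow> 'e \<Rightarrow> 'e \<Rightarrow> real" and g :: "'b \<Rightarrow> 'd \<Rightarrow> 'd \<Rightarrow> real"
  assumes iso: "isometric_immersion M gM B g f"
begin

abbreviation "nspace \<equiv> normal_space M B f g"
abbreviation "tan_part \<equiv> tangential M B f g"
abbreviation "nor_part \<equiv> normal M B f g"

lemma gB: "riemannian_metric B g" and gM: "riemannian_metric M gM"
  and induced: "gM x u v = g (f x) (df x u) (df x v)"
  using iso unfolding isometric_immersion_def by blast+

lemma g_bilinear: "bilinear (g q)" and g_sym: "g q a b = g q b a"
  and gM_bilinear: "bilinear (gM x)" and gM_pos: "u \<noteq> 0 \<Longrightarrow> gM x u u > 0"
  using gB gM unfolding riemannian_metric_def by simp_all

lemmas g_simps = bilinear_ladd[OF g_bilinear] bilinear_radd[OF g_bilinear]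
  bilinear_lsub[OF g_bilinear] bilinear_rsub[OF g_bilinear]
  bilinear_lmul[OF g_bilinear] bilinear_rmul[OF g_bilinear]
  bilinear_lzero[OF g_bilinear] bilinear_rzero[OF g_bilinear]

lemma subspace_nspace: "subspace (nspace x)"
  unfolding subspace_def normal_space_def by (simp add: g_simps)

text \<open>The tangential part of an ambient vector exists by the Riesz representation of linear forms
  in the induced metric.\<close>

lemma tangential_exists: "\<exists>u. v - df x u \<in> nspace x"
proof -
  let ?L = "\<lambda>u. \<Sum>b\<in>Basis. gM x b u *\<^sub>R b"
  have lin: "linear ?L"
    by (rule linearI) (simp_all add: bilinear_radd[OF gM_bilinear] bilinear_rmul[OF gM_bilinear]
        scaleR_add_left sum.distrib scaleR_sum_right)
  have form: "linear (\<lambda>w. gM x w u)" "linear (\<lambda>w. g (f x) (df x w) v)" for u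
    using gM_bilinear[of x] g_bilinear[of "f x"]
      linear_compose[OF dmap_linear[of x], of "\<lambda>w. g (f x) w v"]
    unfolding bilinear_def o_def by simp_all
  have "u = 0" if "?L u = 0" for u
  proof (rule ccontr)
    have "gM x b u = 0" if "b \<in> Basis" for b
      using arg_cong[OF \<open>?L u = 0\<close>, of "\<lambda>z. z \<bullet> b"] that
        by (simp add: inner_sum_left inner_Basis if_distrib cong: if_cong)
    then have "gM x w u = 0" for w
      using linear_eq_on_span[OF form(1) linear_zero, of Basis u w] by simp
    moreover assume "u \<noteq> 0"
    ultimately show False using gM_pos[of u x] by simp
  qed
  then have "inj ?L" using linear_injective_0[OF lin] by blast
  then have "surj ?L" using linear_injective_imp_surjective[OF lin] by blast
  from surjD[OF this, of "\<Sum>b\<in>Basis. g (f x) (df x b) v *\<^sub>R b"]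
  obtain u where u: "(\<Sum>b\<in>Basis. g (f x) (df x b) v *\<^sub>R b) = ?L u" ..
  have "gM x b u = g (f x) (df x b) v" if "b \<in> Basis" for b
    using arg_cong[OF u, of "\<lambda>z. z \<bullet> b"] that
    by (simp add: inner_sum_left inner_Basis if_distrib cong: if_cong)
  then have "gM x w u = g (f x) (df x w) v" for w
    using linear_eq_on_span[OF form, of Basis u w] by simp
  then show ?thesis
    by (intro exI[of _ u]) (simp add: normal_space_def g_simps induced[symmetric])
qed

lemma tangential_unique:
  assumes "v - df x u \<in> nspace x" "v - df x w \<in> nspace x" shows "u = w"
proof (rule ccontr)
  assume "u \<noteq> w"
  then have "gM x (u - w) (u - w) > 0" by (intro gM_pos) simp
  moreover have "g (f x) (df x (u - w)) (v - df x w - (v - df x u)) = 0"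
    using subspace_diff[OF subspace_nspace assms(2,1)] unfolding normal_space_def by blast
  ultimately show False by (simp add: induced linear_diff[OF dmap_linear])
qed

lemma tangential_eqI: "v - df x u \<in> nspace x \<Longrightarrow> tan_part x v = u"
  unfolding tangential_def by (rule the_equality) (auto intro: tangential_unique)

lemma normal_in_nspace: "nor_part x v \<in> nspace x"
  using tangential_exists[of v x] tangential_eqI unfolding normal_def by blast

lemma tangential_of_normal: "v \<in> nspace x \<Longrightarrow> tan_part x v = 0"
  by (rule tangential_eqI) (simp add: linear_0[OF dmap_linear])

lemma tangential_linear: "linear (tan_part x)"
proof (rule linearI; rule tangential_eqI)
  fix v w :: 'd and c :: real
  show "v + w - df x (tan_part x v + tan_part x w) \<in> nspace x"
    using subspace_add[OF subspace_nspace normal_in_nspace normal_in_nspace, of x v w]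
    by (simp add: normal_def linear_add[OF dmap_linear] algebra_simps)
  show "c *\<^sub>R v - df x (c *\<^sub>R tan_part x v) \<in> nspace x"
    using subspace_scale[OF subspace_nspace normal_in_nspace, of c x v]
    by (simp add: normal_def linear_cmul[OF dmap_linear] algebra_simps)
qed

lemma normal_linear: "linear (nor_part x)"
  unfolding normal_def[abs_def]
  using linear_compose_sub[OF linear_id linear_compose[OF tangential_linear dmap_linear]]
  by (simp add: o_def)

text \<open>The tangential part of \<open>D\<^sub>X (f\<^sub>*Y)\<close> is given by the Levi-Civita connection of the induced
  metric: paired with \<open>f\<^sub>*Z\<close>, the difference of the two is symmetric in \<open>X, Y\<close>, both connections being
  torsion free, and skew in \<open>Y, Z\<close>, both being metric. Such a form vanishes.\<close>

lemma gauss_formula: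
  assumes lcB: "levi_civita B g nablaB" and lc: "levi_civita M gM nabla"
    and X: "near x (\<lambda>U. smooth_vf M U X)" and Y: "near x (\<lambda>U. smooth_vf M U Y)"
  shows "tan_part x (D x (X x) (\<lambda>y. df y (Y y))) = nabla x (X x) Y"
proof -
  let ?S = "\<lambda>X. near x (\<lambda>U. smooth_vf M U X)"
  let ?T = "\<lambda>X Y Z. g (f x) (D x (X x) (\<lambda>y. df y (Y y))) (df x (Z x)) - gM x (nabla x (X x) Y) (Z x)"
  have sym: "?T X Y Z = ?T Y X Z" if "?S X" "?S Y" for X Y Z
  proof -
    have "g (f x) (D x (X x) (\<lambda>y. df y (Y y)) - D x (Y x) (\<lambda>y. df y (X y))) (df x (Z x)) =
        gM x (nabla x (X x) Y - nabla x (Y x) X) (Z x)"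
      using pullback_torsion_free[OF _ _ _ that, of nabla] lc lcB
      unfolding levi_civita_def by (simp add: induced)
    then show ?thesis by (simp add: g_simps bilinear_lsub[OF gM_bilinear])
  qed
  have skew: "?T X Y Z = - ?T X Z Y" if "?S Y" "?S Z" for X Y Z
  proof -
    have met: "metric_connection B g nablaB" "metric_connection M gM nabla"
      using lc lcB unfolding levi_civita_def by auto
    have "gM x (nabla x (X x) Y) (Z x) + gM x (Y x) (nabla x (X x) Z) =
        dfun M (\<lambda>y. gM y (Y y) (Z y)) x (X x)"
      using met(2) that unfolding metric_connection_def by simp
    also have "\<dots> = g (f x) (D x (X x) (\<lambda>y. df y (Y y))) (df x (Z x))
        + g (f x) (df x (Y x)) (D x (X x) (\<lambda>y. df y (Z y)))"
      using pullback_metric[OF gB met(1) section_at_push_forward[OF that(1)]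
          section_at_push_forward[OF that(2)], of "X x"] by (simp add: induced)
    finally show ?thesis
      using g_sym[of "f x"] by (simp add: induced)
  qed
  \<comment> \<open>Six alternating steps return to the triple \<open>X, Y, Z\<close> with the opposite sign.\<close>
  have zero: "?T X Y Z = 0" if "?S Z" for Z
    using sym[OF X Y, of Z] skew[OF X that, of Y] sym[OF Y that, of X] skew[OF Y X, of Z]
      sym[OF that X, of Y] skew[OF that Y, of X] by linarith
  have "g (f x) (D x (X x) (\<lambda>y. df y (Y y))) (df x z) = gM x (nabla x (X x) Y) z" for z
  proof -
    obtain c where c: "c \<in> M" "x \<in> fst c" using chart_at_in[OF M] by blast
    show ?thesis
      using zero[OF near_coord_field[OF M c], of "tcoord M c x z"] coord_field_tcoord[OF M c] by simp
  qed
  then show ?thesis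
    by (intro tangential_eqI) (simp add: normal_space_def g_simps induced g_sym)
qed

lemma normal_frame_expansion:
  assumes "orthonormal_normal_frame M B f g U r N" "x \<in> U" "v \<in> nspace x"
  shows "v = (\<Sum>\<alpha>=1..r. g (f x) v (N \<alpha> x) *\<^sub>R N \<alpha> x)"
proof -
  have sp: "span ((\<lambda>\<alpha>. N \<alpha> x) ` {1..r}) = nspace x"
    and on: "\<And>\<alpha> \<beta>. \<alpha> \<in> {1..r} \<Longrightarrow> \<beta> \<in> {1..r} \<Longrightarrow> g (f x) (N \<alpha> x) (N \<beta> x) = (if \<alpha> = \<beta> then 1 else 0)"
    using assms(1,2) unfolding orthonormal_normal_frame_def by blast+
  let ?P = "\<lambda>v. \<Sum>\<alpha>=1..r. g (f x) v (N \<alpha> x) *\<^sub>R N \<alpha> x"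
  have P: "linear ?P"
    by (rule linearI) (simp_all add: g_simps scaleR_add_left sum.distrib scaleR_sum_right)
  have "?P (N \<alpha> x) = N \<alpha> x" if "\<alpha> \<in> {1..r}" for \<alpha>
  proof -
    have "?P (N \<alpha> x) = (\<Sum>\<beta>=1..r. if \<alpha> = \<beta> then N \<beta> x else 0)"
      by (rule sum.cong) (use on that in auto)
    then show ?thesis using that by simp
  qed
  then have "?P w = w" if "w \<in> (\<lambda>\<alpha>. N \<alpha> x) ` {1..r}" for w
    using that by blast
  from linear_eq_on_span[OF P linear_ident this] show ?thesis
    using sp assms(3) by simp
qed

end

section \<open>Anti-invariant submanifolds\<close>

theorem proposition3p16:
  fixes M :: "('m::{t2_space,second_countable_topology}, 'e::euclidean_space) chart set"
    and B :: "('b::{t2_space,second_countable_topology}, 'd::euclidean_space) chart set"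
    and gM :: "'m \<Rightarrow> 'e \<Rightarrow> 'e \<Rightarrow> real"
    and g :: "'b \<Rightarrow> 'd \<Rightarrow> 'd \<Rightarrow> real"
    and J :: "'b \<Rightarrow> 'd \<Rightarrow> 'd"
    and f :: "'m \<Rightarrow> 'b"
    and nablaB :: "'b \<Rightarrow> 'd \<Rightarrow> ('b \<Rightarrow> 'd) \<Rightarrow> 'd"
    and nabla :: "'m \<Rightarrow> 'e \<Rightarrow> ('m \<Rightarrow> 'e) \<Rightarrow> 'e"
    and D :: "'m \<Rightarrow> 'e \<Rightarrow> ('m \<Rightarrow> 'd) \<Rightarrow> 'd"
    and r :: nat
    and U :: "'m set"
    and N :: "nat \<Rightarrow> 'm \<Rightarrow> 'd"
    and X Y :: "'m \<Rightarrow> 'e"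
  assumes "locally_metallic B J g nablaB"
    and "isometric_immersion M gM B g f"
    and "DIM('d) = DIM('e) + r"
    and "anti_invariant M B f g J"
    and "levi_civita M gM nabla"
    and "pullback_connection M B f nablaB D"
    and "open U"
    and "orthonormal_normal_frame M B f g U r N"
    and "smooth_vf M UNIV X"
    and "smooth_vf M UNIV Y"
  shows "\<forall>x\<in>U.
      (\<Sum>\<alpha>=1..r. h_coeff M B f g D (N \<alpha>) X Y x *\<^sub>R tangential M B f g x (J (f x) (N \<alpha> x)))
      = - (\<Sum>\<alpha>=1..r. g (f x) (J (f x) (dmap M B f x (Y x))) (N \<alpha> x) *\<^sub>R
             shape_operator M B f g D (N \<alpha>) x (X x))
    \<and> (\<Sum>\<alpha>=1..r. h_coeff M B f g D (N \<alpha>) X Y x *\<^sub>R normal M B f g x (J (f x) (N \<alpha> x)))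
      = (\<Sum>\<alpha>=1..r. g (f x) (J (f x) (dmap M B f x (Y x))) (N \<alpha> x) *\<^sub>R
             normal_connection M B f g D x (X x) (N \<alpha>))
        + (\<Sum>\<alpha>=1..r. dfun M (\<lambda>y. g (f y) (J (f y) (dmap M B f y (Y y))) (N \<alpha> y)) x (X x) *\<^sub>R N \<alpha> x)
        - J (f x) (dmap M B f x (nabla x (X x) Y))"
proof
  fix x assume x: "x \<in> U"
  interpret riemannian_immersion M B f nablaB D gM g
    by unfold_locales (use assms(2,6) in \<open>auto simp: isometric_immersion_def\<close>)
  have lcB: "levi_civita B g nablaB" and J: "tensor_field_11 B J"
    and par: "\<And>q w Z. near q (\<lambda>U. smooth_vf B U Z) \<Longrightarrow> cov_deriv_11 nablaB J q w Z = 0"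
    using assms(1) unfolding locally_metallic_def metallic_riemannian_def by blast+
  have Jlin: "linear (J q)" for q using J unfolding tensor_field_11_def by blast
  have metB: "metric_connection B g nablaB" using lcB unfolding levi_civita_def by blast
  have X: "near x (\<lambda>U. smooth_vf M U X)" and Y: "near x (\<lambda>U. smooth_vf M U Y)"
    using assms(9,10) unfolding near_def by (auto intro!: exI[of _ UNIV])
  have N: "section_at x (N \<alpha>)" if "\<alpha> \<in> {1..r}" for \<alpha>
    using assms(7,8) x that unfolding orthonormal_normal_frame_def near_def by blast
  have N_normal: "N \<alpha> x \<in> nspace x" if "\<alpha> \<in> {1..r}" for \<alpha>
    using assms(8) x that span_base[of "N \<alpha> x" "(\<lambda>\<alpha>. N \<alpha> x) ` {1..r}"]
    unfolding orthonormal_normal_frame_def by blast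
  have anti: "J (f y) (df y w) \<in> nspace y" for y w
    using assms(4) unfolding anti_invariant_def by blast

  let ?V = "\<lambda>y. df y (Y y)" and ?u = "X x"
  let ?\<phi> = "\<lambda>\<alpha> y. g (f y) (J (f y) (df y (Y y))) (N \<alpha> y)"
  let ?h = "\<lambda>\<alpha>. h_coeff M B f g D (N \<alpha>) X Y x"
  note V = section_at_push_forward[OF Y]
  note JV = pullback_parallel[OF J par V]

  have \<phi>: "fun_at x (?\<phi> \<alpha>)" if "\<alpha> \<in> {1..r}" for \<alpha>
    using pullback_metric[OF gB metB conjunct1[OF JV] N[OF that]] by blast
  have S: "section_at x (\<lambda>y. \<Sum>\<alpha>=1..r. ?\<phi> \<alpha> y *\<^sub>R N \<alpha> y)"
    "D x ?u (\<lambda>y. \<Sum>\<alpha>=1..r. ?\<phi> \<alpha> y *\<^sub>R N \<alpha> y) =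
      (\<Sum>\<alpha>=1..r. dfun M (?\<phi> \<alpha>) x ?u *\<^sub>R N \<alpha> x + ?\<phi> \<alpha> x *\<^sub>R D x ?u (N \<alpha>))"
    using section_at_sum_and_D_sum[of "{1..r}" x ?\<phi> N ?u] \<phi> N by simp_all
  \<comment> \<open>The derivative of \<open>JV\<close> by the Leibniz rule for its expansion in the normal frame.\<close>
  have "\<forall>\<^sub>F y in nhds x. (\<Sum>\<alpha>=1..r. ?\<phi> \<alpha> y *\<^sub>R N \<alpha> y) = J (f y) (?V y)"
    unfolding eventually_nhds using assms(7) x normal_frame_expansion[OF assms(8) _ anti]
    by (intro exI[of _ U]) auto
  then have "D x ?u (\<lambda>y. J (f y) (?V y)) = D x ?u (\<lambda>y. \<Sum>\<alpha>=1..r. ?\<phi> \<alpha> y *\<^sub>R N \<alpha> y)"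
    by (rule D_local[OF S(1), symmetric])
  then have right: "J (f x) (D x ?u ?V) =
      (\<Sum>\<alpha>=1..r. dfun M (?\<phi> \<alpha>) x ?u *\<^sub>R N \<alpha> x) + (\<Sum>\<alpha>=1..r. ?\<phi> \<alpha> x *\<^sub>R D x ?u (N \<alpha>))"
    using S(2) conjunct2[OF JV, of ?u] by (simp add: sum.distrib)

  \<comment> \<open>The same derivative by the Gauss formula.\<close>
  have "nor_part x (D x ?u ?V) = (\<Sum>\<alpha>=1..r. ?h \<alpha> *\<^sub>R N \<alpha> x)"
    using normal_frame_expansion[OF assms(8) x normal_in_nspace] unfolding h_coeff_def .
  then have "D x ?u ?V = df x (nabla x ?u Y) + (\<Sum>\<alpha>=1..r. ?h \<alpha> *\<^sub>R N \<alpha> x)"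
    using gauss_formula[OF lcB assms(5) X Y] unfolding normal_def by (simp add: algebra_simps)
  then have left: "J (f x) (D x ?u ?V) =
      J (f x) (df x (nabla x ?u Y)) + (\<Sum>\<alpha>=1..r. ?h \<alpha> *\<^sub>R J (f x) (N \<alpha> x))"
    by (simp add: linear_add[OF Jlin] linear_sum[OF Jlin] linear_cmul[OF Jlin])

  have fixed: "nor_part x v = v" if "v \<in> nspace x" for v
    using tangential_of_normal[OF that] by (simp add: normal_def linear_0[OF dmap_linear])
  have main: "(\<Sum>\<alpha>=1..r. ?h \<alpha> *\<^sub>R J (f x) (N \<alpha> x)) =
      (\<Sum>\<alpha>=1..r. ?\<phi> \<alpha> x *\<^sub>R D x ?u (N \<alpha>)) +
      ((\<Sum>\<alpha>=1..r. dfun M (?\<phi> \<alpha>) x ?u *\<^sub>R N \<alpha> x) - J (f x) (df x (nabla x ?u Y)))"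
    (is "?lhs = ?a + ?b")
    using left right by (simp add: algebra_simps)
  have b: "?b \<in> nspace x"
    by (intro subspace_diff subspace_sum subspace_scale subspace_nspace anti N_normal)
  have "tan_part x ?lhs = tan_part x ?a"
    using main linear_add[OF tangential_linear, of x ?a ?b] tangential_of_normal[OF b] by simp
  moreover have "nor_part x ?lhs = nor_part x ?a + ?b"
    using main linear_add[OF normal_linear, of x ?a ?b] fixed[OF b] by simp
  ultimately show "(\<Sum>\<alpha>=1..r. ?h \<alpha> *\<^sub>R tan_part x (J (f x) (N \<alpha> x)))
      = - (\<Sum>\<alpha>=1..r. ?\<phi> \<alpha> x *\<^sub>R shape_operator M B f g D (N \<alpha>) x ?u)
    \<and> (\<Sum>\<alpha>=1..r. ?h \<alpha> *\<^sub>R nor_part x (J (f x) (N \<alpha> x)))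
      = (\<Sum>\<alpha>=1..r. ?\<phi> \<alpha> x *\<^sub>R normal_connection M B f g D x ?u (N \<alpha>))
        + (\<Sum>\<alpha>=1..r. dfun M (?\<phi> \<alpha>) x ?u *\<^sub>R N \<alpha> x) - J (f x) (df x (nabla x ?u Y))"
    by (simp add: linear_sum[OF tangential_linear] linear_cmul[OF tangential_linear]
        linear_sum[OF normal_linear] linear_cmul[OF normal_linear]
        shape_operator_def normal_connection_def sum_negf)
qed

end
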